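(* The family of coverability languages of RPNs strictly includes the union of the family of coverability languages of Petri nets and the family of context-free languages.
   Context: A Recursive Petri Net (RPN) is a tuple $\mathcal N=\langle P,T,W^+,W^-,\Omega\rangle$ where $P$ is a finite set of places, $T=T_{el}\uplus T_{ab}\uplus T_{\tau}$ is a finite set of transitions disjoint from $P$ (elementary, abstract and cut transitions), $W^-\in\mathbb N^{P\times T}$, $W^+\in\mathbb N^{P\times(T_{el}\uplus T_{ab})}$, and $\Omega:T_{ab}\to\mathbb N^P$. Write $W^{\pm}(t)\in\mathbb N^P$ for the column of $t$; markings are compared componentwise. A (concrete) state is either the empty tree $\emptyset$ or a finite rooted tree whose vertices (threads) are taken from a fixed countably infinite set $\mathcal V$, each vertex $v$ labelled by a marking $M_s(v)\in\mathbb N^P$ and each edge labelled by a vector in $\{W^+(t):t\in T_{ab}\}$. Firing rule: a thread $v$ of a state $s\neq\emptyset$ can fire $t$ if $W^-(t)\le M_s(v)$, giving $s\xrightarrow{(v,t)}s'$ where: if $t\in T_{el}$, the marking of $v$ becomes $M_s(v)-W^-(t)+W^+(t)$; if $t\in T_{ab}$, the marking of $v$ becomes $M_s(v)-W^-(t)$ and a new child $w$ of $v$ (a vertex never used before) is created with marking $\Omega(t)$ and edge $v\to w$ labelled $W^+(t)$; if $t\in T_\tau$, the subtree rooted at $v$ is deleted, and if $v$ is the root the result is $\emptyset$, otherwise the marking of the parent $u$ of $v$ is increased by the label of the edge $u\to v$. Quasi-order on states: $\emptyset\preceq s$ for every $s$; for $s\neq\emptyset$, $s\preceq s'$ iff there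 is an injective map $f$ from the vertices of $s$ to those of $s'$ with $M_s(v)\le M_{s'}(f(v))$ for all $v$ and, for every edge $v\to w$ of $s$ labelled $m$, an edge $f(v)\to f(w)$ of $s'$ labelled $m'\ge m$. A labelled RPN has additionally a labelling $\lambda:T\to\Sigma\cup\{\varepsilon\}$ ($\Sigma$ a finite alphabet), extended to sequences as a monoid morphism. For a labelled RPN $\mathcal N$, initial state $s_0$ and finite set of states $S_f$, its coverability language is $\mathcal L_C(\mathcal N,s_0,S_f)=\{\lambda(\sigma)\mid s_0\xrightarrow{\sigma}s,\ s_f\preceq s\text{ for some }s_f\in S_f\}$ ($\sigma$ finite); the family of coverability languages of RPNs consists of all such languages. Similarly the coverability language of a labelled Petri net with initial marking $m_0$ and finite set $F$ of final markings is $\{\lambda(\sigma)\mid m_0\xrightarrow{\sigma}m,\ m\ge m_f\text{ for some }m_f\in F\}$. *)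

theory Defs
  imports Main
begin

section \<open>Vectors and labellings\<close>

text \<open>The vectors of \<open>\<nat>\<^sup>P\<close> are the functions vanishing outside \<open>P\<close>; the componentwise order is then
  the library order \<open>\<le>\<close> on functions.\<close>

definition vecs :: "'p set \<Rightarrow> ('p \<Rightarrow> nat) set" where
  "vecs P = {m. \<forall>p. p \<notin> P \<longrightarrow> m p = 0}"

text \<open>\<open>None\<close> plays the role of the empty word.\<close>

definition is_labelling :: "'t set \<Rightarrow> 'a set \<Rightarrow> ('t \<Rightarrow> 'a option) \<Rightarrow> bool" where
  "is_labelling T \<Sigma> lam \<longleftrightarrow> finite \<Sigma> \<and> (\<forall>t\<in>T. lam t = None \<or> (\<exists>a\<in>\<Sigma>. lam t = Some a))"

definition label_word :: "('t \<Rightarrow> 'a option) \<Rightarrow> 't list \<Rightarrow> 'a list" where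
  "label_word lam ts = concat (map (\<lambda>t. case lam t of None \<Rightarrow> [] | Some a \<Rightarrow> [a]) ts)"


section \<open>Recursive Petri nets\<close>

text \<open>Places and transitions live in different types, hence are disjoint. The values of \<open>Wplus\<close>
  on cut transitions and of \<open>Omega\<close> on non-abstract transitions are irrelevant.\<close>

record ('p, 't) rpn =
  places :: "'p set"
  Tel :: "'t set"
  Tab :: "'t set"
  Tcut :: "'t set"
  Wminus :: "'t \<Rightarrow> 'p \<Rightarrow> nat"
  Wplus :: "'t \<Rightarrow> 'p \<Rightarrow> nat"
  Omega :: "'t \<Rightarrow> 'p \<Rightarrow> nat"

definition transitions :: "('p, 't) rpn \<Rightarrow> 't set" where
  "transitions N = Tel N \<union> Tab N \<union> Tcut N"

definition is_rpn :: "('p, 't) rpn \<Rightarrow> bool" where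
  "is_rpn N \<longleftrightarrow>
     finite (places N) \<and> finite (transitions N) \<and>
     Tel N \<inter> Tab N = {} \<and> Tel N \<inter> Tcut N = {} \<and> Tab N \<inter> Tcut N = {} \<and>
     (\<forall>t\<in>transitions N. Wminus N t \<in> vecs (places N)) \<and>
     (\<forall>t\<in>Tel N \<union> Tab N. Wplus N t \<in> vecs (places N)) \<and>
     (\<forall>t\<in>Tab N. Omega N t \<in> vecs (places N))"

type_synonym thread = nat

record 'p state =
  verts :: "thread set"
  edges :: "(thread \<times> thread) set"
  marking :: "thread \<Rightarrow> 'p \<Rightarrow> nat"
  elabel :: "thread \<times> thread \<Rightarrow> 'p \<Rightarrow> nat"

definition empty_state :: "'p state" where
  "empty_state = \<lparr>verts = {}, edges = {}, marking = (\<lambda>_ _. 0), elabel = (\<lambda>_ _. 0)\<rparr>"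

definition rooted_tree :: "'v set \<Rightarrow> ('v \<times> 'v) set \<Rightarrow> 'v \<Rightarrow> bool" where
  "rooted_tree V E r \<longleftrightarrow>
     finite V \<and> E \<subseteq> V \<times> V \<and> r \<in> V \<and>
     (\<forall>u. (u, r) \<notin> E) \<and>
     (\<forall>v\<in>V - {r}. \<exists>!u. (u, v) \<in> E) \<and>
     (\<forall>v\<in>V. (r, v) \<in> E\<^sup>*)"

text \<open>A state is the empty tree iff its vertex set is empty. The values of \<open>marking\<close> and \<open>elabel\<close>
  off the vertices and edges are irrelevant.\<close>

definition is_state :: "('p, 't) rpn \<Rightarrow> 'p state \<Rightarrow> bool" where
  "is_state N s \<longleftrightarrow>
     ((verts s = {} \<and> edges s = {}) \<or> (\<exists>r. rooted_tree (verts s) (edges s) r)) \<and>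
     (\<forall>v\<in>verts s. marking s v \<in> vecs (places N)) \<and>
     (\<forall>e\<in>edges s. elabel s e \<in> Wplus N ` Tab N)"

definition subtree :: "'p state \<Rightarrow> thread \<Rightarrow> thread set" where
  "subtree s v = {w. (v, w) \<in> (edges s)\<^sup>*}"

text \<open>\<open>fire N H s v t s'\<close>: thread \<open>v\<close> fires \<open>t\<close> in \<open>s\<close> and yields \<open>s'\<close>, where \<open>H\<close> collects the
  vertices of the earlier states of the run, so that a created thread avoids all vertices
  used so far.\<close>

inductive fire ::
  "('p, 't) rpn \<Rightarrow> thread set \<Rightarrow> 'p state \<Rightarrow> thread \<Rightarrow> 't \<Rightarrow> 'p state \<Rightarrow> bool"
  for N H s where
  elementary:
    "\<lbrakk>v \<in> verts s; t \<in> Tel N; Wminus N t \<le> marking s v\<rbrakk> \<Longrightarrow>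
     fire N H s v t
       (s\<lparr>marking := (marking s)(v := \<lambda>p. marking s v p - Wminus N t p + Wplus N t p)\<rparr>)"
| abstract:
    "\<lbrakk>v \<in> verts s; t \<in> Tab N; Wminus N t \<le> marking s v; w \<notin> H \<union> verts s\<rbrakk> \<Longrightarrow>
     fire N H s v t
       \<lparr>verts = insert w (verts s),
        edges = insert (v, w) (edges s),
        marking = (marking s)(v := \<lambda>p. marking s v p - Wminus N t p, w := Omega N t),
        elabel = (elabel s)((v, w) := Wplus N t)\<rparr>"
| cut_root:
    "\<lbrakk>v \<in> verts s; t \<in> Tcut N; Wminus N t \<le> marking s v; \<forall>u. (u, v) \<notin> edges s\<rbrakk> \<Longrightarrow>
     fire N H s v t empty_state"
| cut_inner:
    "\<lbrakk>v \<in> verts s; t \<in> Tcut N; Wminus N t \<le> marking s v; (u, v) \<in> edges s\<rbrakk> \<Longrightarrow>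
     fire N H s v t
       (s\<lparr>verts := verts s - subtree s v,
          edges := edges s \<inter> ((- subtree s v) \<times> (- subtree s v)),
          marking := (marking s)(u := \<lambda>p. marking s u p + elabel s (u, v) p)\<rparr>)"

inductive run ::
  "('p, 't) rpn \<Rightarrow> thread set \<Rightarrow> 'p state \<Rightarrow> (thread \<times> 't) list \<Rightarrow> 'p state \<Rightarrow> bool"
  for N where
  Nil: "run N H s [] s"
| Cons: "\<lbrakk>fire N H s v t s'; run N (H \<union> verts s) s' \<sigma> s''\<rbrakk> \<Longrightarrow> run N H s ((v, t) # \<sigma>) s''"

definition state_le :: "'p state \<Rightarrow> 'p state \<Rightarrow> bool" (infix "\<preceq>" 50) where
  "s \<preceq> s' \<longleftrightarrow>
     verts s = {} \<or>
     (\<exists>f. inj_on f (verts s) \<and> f ` verts s \<subseteq> verts s' \<and>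
          (\<forall>v\<in>verts s. marking s v \<le> marking s' (f v)) \<and>
          (\<forall>(v, w)\<in>edges s. (f v, f w) \<in> edges s' \<and> elabel s (v, w) \<le> elabel s' (f v, f w)))"

definition rpn_cov_lang ::
  "('p, 't) rpn \<Rightarrow> ('t \<Rightarrow> 'a option) \<Rightarrow> 'p state \<Rightarrow> 'p state set \<Rightarrow> 'a list set" where
  "rpn_cov_lang N lam s0 Sf =
     {label_word lam (map snd \<sigma>) | \<sigma>. \<exists>s. run N {} s0 \<sigma> s \<and> (\<exists>sf\<in>Sf. sf \<preceq> s)}"

text \<open>In the three families below, the finite sets of places, transitions and nonterminals are
  taken, without loss of generality, to be sets of natural numbers.\<close>

definition rpn_cov_langs :: "'a list set set" where
  "rpn_cov_langs =
     {rpn_cov_lang N lam s0 Sf | (N :: (nat, nat) rpn) \<Sigma> lam s0 Sf.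
        is_rpn N \<and> is_labelling (transitions N) \<Sigma> lam \<and>
        is_state N s0 \<and> finite Sf \<and> (\<forall>sf\<in>Sf. is_state N sf)}"


section \<open>Petri nets\<close>

record ('p, 't) petri_net =
  pn_places :: "'p set"
  pn_trans :: "'t set"
  pn_pre :: "'t \<Rightarrow> 'p \<Rightarrow> nat"
  pn_post :: "'t \<Rightarrow> 'p \<Rightarrow> nat"

definition is_petri_net :: "('p, 't) petri_net \<Rightarrow> bool" where
  "is_petri_net N \<longleftrightarrow>
     finite (pn_places N) \<and> finite (pn_trans N) \<and>
     (\<forall>t\<in>pn_trans N. pn_pre N t \<in> vecs (pn_places N) \<and> pn_post N t \<in> vecs (pn_places N))"

inductive pn_run ::
  "('p, 't) petri_net \<Rightarrow> ('p \<Rightarrow> nat) \<Rightarrow> 't list \<Rightarrow> ('p \<Rightarrow> nat) \<Rightarrow> bool"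
  for N where
  Nil: "pn_run N m [] m"
| Cons: "\<lbrakk>t \<in> pn_trans N; pn_pre N t \<le> m;
          pn_run N (\<lambda>p. m p - pn_pre N t p + pn_post N t p) \<sigma> m'\<rbrakk> \<Longrightarrow>
         pn_run N m (t # \<sigma>) m'"

definition pn_cov_lang ::
  "('p, 't) petri_net \<Rightarrow> ('t \<Rightarrow> 'a option) \<Rightarrow> ('p \<Rightarrow> nat) \<Rightarrow> ('p \<Rightarrow> nat) set \<Rightarrow> 'a list set"
where
  "pn_cov_lang N lam m0 F =
     {label_word lam \<sigma> | \<sigma>. \<exists>m. pn_run N m0 \<sigma> m \<and> (\<exists>mf\<in>F. mf \<le> m)}"

definition pn_cov_langs :: "'a list set set" where
  "pn_cov_langs =
     {pn_cov_lang N lam m0 F | (N :: (nat, nat) petri_net) \<Sigma> lam m0 F.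
        is_petri_net N \<and> is_labelling (pn_trans N) \<Sigma> lam \<and>
        m0 \<in> vecs (pn_places N) \<and> finite F \<and> F \<subseteq> vecs (pn_places N)}"


section \<open>Context-free languages\<close>

datatype ('n, 'a) symbol = Nt 'n | Tm 'a

record ('n, 'a) cfg =
  nonterms :: "'n set"
  terms :: "'a set"
  prods :: "('n \<times> ('n, 'a) symbol list) set"
  start :: 'n

definition is_cfg :: "('n, 'a) cfg \<Rightarrow> bool" where
  "is_cfg G \<longleftrightarrow>
     finite (nonterms G) \<and> finite (terms G) \<and> finite (prods G) \<and> start G \<in> nonterms G \<and>
     prods G \<subseteq> nonterms G \<times> lists (Nt ` nonterms G \<union> Tm ` terms G)"

definition derives :: "('n, 'a) cfg \<Rightarrow> (('n, 'a) symbol list \<times> ('n, 'a) symbol list) set" where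
  "derives G = {(x @ [Nt A] @ y, x @ w @ y) | x A w y. (A, w) \<in> prods G}"

definition cfg_lang :: "('n, 'a) cfg \<Rightarrow> 'a list set" where
  "cfg_lang G = {u. ([Nt (start G)], map Tm u) \<in> (derives G)\<^sup>*}"

definition cf_langs :: "'a list set set" where
  "cf_langs = {cfg_lang G | (G :: (nat, 'a) cfg). is_cfg G}"

end

theory Submission imports Defs begin

text \<open>If \<open>L\<^sub>1\<close> is context-free and \<open>L\<^sub>2\<close> is a coverability language of a Petri net, then \<open>L\<^sub>1L\<^sub>2\<close> is a
  coverability language of an RPN: a chain of threads serves as the stack of a leftmost derivation,
  and when the derivation is over the root, then the only thread, runs the Petri net. Taking
  \<open>L\<^sub>2 = {\<epsilon>}\<close> or \<open>L\<^sub>1 = {\<epsilon>}\<close> gives both inclusions. The concatenation of \<open>{a\<^sup>nb\<^sup>n}\<close> and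
  \<open>{c\<^sup>id\<^sup>ke\<^sup>j | i \<ge> k \<ge> j}\<close> separates: by Dickson's lemma a Petri net accepting every \<open>a\<^sup>nb\<^sup>n\<close> accepts some
  \<open>a\<^sup>jb\<^sup>i\<close> with \<open>i < j\<close>, and pumping \<open>c\<^sup>nd\<^sup>ne\<^sup>n\<close> down and up shows that the language is not context-free.\<close>

section \<open>Context-free grammars\<close>

text \<open>Coverability acceptance shapes both halves. A run may end above a final state, so a
  Petri net can keep one count below another but cannot force two unbounded counts to agree:
  \<open>balanced\<close> is already out of reach. Hence the second factor is a chain of
  inequalities, and equality only emerges from pumping in both directions. In the simulation, a run
  that stops in the middle of a derivation must not be accepted. The marker \<open>Nt Z\<close>
  closes the form of the root and of no other thread, so it stands alone exactly when nothing is
  left to derive and no call is pending. Final states and copied Petri net transitions both ask for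
  it. Places for forms are suffixes of right-hand sides and of the start form, a finite set; the
  unbounded part of a sentential form is spread over the depth of the tree. As the two factors have
  disjoint alphabets and both contain the empty word, each negative argument can make the other
  factor vanish.\<close>

inductive leftmost :: "('n, 'a) cfg \<Rightarrow> ('n, 'a) symbol list \<Rightarrow> 'a list \<Rightarrow> bool" for G where
  Nil: "leftmost G [] []"
| Tm: "leftmost G x u \<Longrightarrow> leftmost G (Tm a # x) (a # u)"
| Nt: "\<lbrakk>(A, w) \<in> prods G; leftmost G (w @ x) u\<rbrakk> \<Longrightarrow> leftmost G (Nt A # x) u"

inductive_cases leftmost_NilE: "leftmost G [] u"
inductive_cases leftmost_NtE: "leftmost G (Nt A # x) u"

text \<open>A derivation step anywhere can be put in front of a leftmost derivation. While the
  prefix \<open>x\<close> is nonempty, the first rule of that derivation stays first; once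
  \<open>x\<close> is used up, the new step is itself leftmost.\<close>

lemma leftmost_expand:
  assumes "leftmost G z u" "z = x @ w @ y" "(A, w) \<in> prods G"
  shows "leftmost G (x @ [Nt A] @ y) u"
  using assms
proof (induction arbitrary: x rule: leftmost.induct)
  case Nil
  then show ?case using leftmost.Nt[of A "[]" G "[]" "[]"] by (auto intro: leftmost.Nil)
next
  case (Tm z u a)
  show ?case
  proof (cases x)
    case Nil
    with Tm have "leftmost G (w @ y) (a # u)" using leftmost.Tm[of G z u a] by simp
    with Tm.prems Nil show ?thesis by (auto intro: leftmost.Nt)
  next
    case (Cons b x')
    with Tm show ?thesis by (auto intro!: leftmost.Tm)
  qed
next
  case (Nt B w' z u)
  show ?case
  proof (cases x)
    case Nil
    with Nt have "leftmost G (w @ y) u" using leftmost.Nt[OF Nt.hyps] by simp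
    with Nt.prems Nil show ?thesis by (auto intro: leftmost.Nt)
  next
    case (Cons b x')
    with Nt.prems have b: "b = Nt B" "z = x' @ w @ y" by auto
    have "leftmost G ((w' @ x') @ [Nt A] @ y) u"
      using Nt.IH[of "w' @ x'"] Nt.prems b by simp
    with Nt.hyps Cons b show ?thesis by (auto intro: leftmost.Nt)
  qed
qed

lemma leftmost_terminals: "leftmost G (map Tm u) u"
  by (induction u) (auto intro: leftmost.intros)

lemma derives_append:
  assumes "(x, y) \<in> (derives G)\<^sup>*"
  shows "(p @ x @ q, p @ y @ q) \<in> (derives G)\<^sup>*"
  using assms
proof (induction rule: rtrancl_induct)
  case (step y z)
  then obtain l A w r where "y = l @ [Nt A] @ r" "z = l @ w @ r" "(A, w) \<in> prods G"
    by (auto simp: derives_def)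
  then have "(p @ y @ q, p @ z @ q) \<in> derives G"
    unfolding derives_def by (auto, metis append.assoc append_Cons)
  with step show ?case by simp
qed simp

lemma leftmost_imp_derives: "leftmost G x u \<Longrightarrow> (x, map Tm u) \<in> (derives G)\<^sup>*"
proof (induction rule: leftmost.induct)
  case (Tm x u a)
  then show ?case using derives_append[of x "map Tm u" G "[Tm a]" "[]"] by simp
next
  case (Nt A w x u)
  have "(Nt A # x, w @ x) \<in> derives G"
    using Nt unfolding derives_def by (auto intro!: exI[of _ "[]"])
  with Nt show ?case by (meson converse_rtrancl_into_rtrancl)
qed simp

lemma derives_iff_leftmost: "(x, map Tm u) \<in> (derives G)\<^sup>* \<longleftrightarrow> leftmost G x u"
proof
  assume "(x, map Tm u) \<in> (derives G)\<^sup>*"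
  then show "leftmost G x u"
  proof (induction rule: converse_rtrancl_induct)
    case base
    show ?case by (rule leftmost_terminals)
  next
    case (step y z)
    then show ?case unfolding derives_def by (auto intro: leftmost_expand[simplified])
  qed
qed (rule leftmost_imp_derives)

lemma cfg_lang_leftmost: "cfg_lang G = {u. leftmost G [Nt (start G)] u}"
  by (simp add: cfg_lang_def derives_iff_leftmost)

text \<open>The number counts the production instances of a parse forest.\<close>

inductive parses :: "('n, 'a) cfg \<Rightarrow> nat \<Rightarrow> ('n, 'a) symbol list \<Rightarrow> 'a list \<Rightarrow> bool" for G where
  Nil: "parses G 0 [] []"
| Tm: "parses G n x u \<Longrightarrow> parses G n (Tm a # x) (a # u)"
| Nt: "\<lbrakk>(A, w) \<in> prods G; parses G k w u; parses G n x v\<rbrakk> \<Longrightarrow>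
       parses G (Suc (k + n)) (Nt A # x) (u @ v)"

inductive_cases parses_NilE: "parses G n [] u"
inductive_cases parses_TmE: "parses G n (Tm a # x) u"
inductive_cases parses_NtE: "parses G n (Nt A # x) u"

lemma parses_append_split:
  assumes "parses G n (x @ y) u"
  shows "\<exists>n1 n2 u1 u2. u = u1 @ u2 \<and> n = n1 + n2 \<and> parses G n1 x u1 \<and> parses G n2 y u2"
  using assms
proof (induction x arbitrary: n u)
  case Nil
  then have "u = [] @ u \<and> n = 0 + n \<and> parses G 0 [] [] \<and> parses G n y u"
    by (simp add: parses.Nil)
  then show ?case by blast
next
  case (Cons s x)
  show ?case
  proof (cases s)
    case (Nt A)
    with Cons.prems obtain w k u' n' v where
      "(A, w) \<in> prods G" "parses G k w u'" "parses G n' (x @ y) v" "n = Suc (k + n')" "u = u' @ v"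
      by (auto elim: parses_NtE)
    moreover from Cons.IH[OF this(3)] obtain n1 n2 u1 u2 where
      "v = u1 @ u2" "n' = n1 + n2" "parses G n1 x u1" "parses G n2 y u2" by blast
    ultimately have "u = (u' @ u1) @ u2" "n = Suc (k + n1) + n2" "parses G (Suc (k + n1)) (s # x) (u' @ u1)"
      "parses G n2 y u2" using Nt by (auto intro: parses.Nt)
    then show ?thesis by blast
  next
    case (Tm a)
    with Cons.prems obtain u' where "parses G n (x @ y) u'" "u = a # u'" by (auto elim: parses_TmE)
    moreover from Cons.IH[OF this(1)] obtain n1 n2 u1 u2 where
      "u' = u1 @ u2" "n = n1 + n2" "parses G n1 x u1" "parses G n2 y u2" by blast
    ultimately have "u = (a # u1) @ u2" "n = n1 + n2" "parses G n1 (s # x) (a # u1)" "parses G n2 y u2"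
      using Tm by (auto intro: parses.Tm)
    then show ?thesis by blast
  qed
qed

text \<open>The continuation \<open>y\<close> is general because a nonterminal needs two of them:
  its siblings \<open>x\<close> are placed before \<open>y\<close>, then its right-hand side before
  \<open>x @ y\<close>.\<close>

lemma parses_imp_leftmost_append:
  "parses G n x u \<Longrightarrow> leftmost G y v \<Longrightarrow> leftmost G (x @ y) (u @ v)"
proof (induction arbitrary: y v rule: parses.induct)
  case (Nt A w k u n x v')
  from Nt.IH(1)[OF Nt.IH(2)[OF Nt.prems]] Nt.hyps(1) show ?case
    by (auto intro: leftmost.Nt)
qed (auto intro: leftmost.intros)

lemma leftmost_imp_parses: "leftmost G x u \<Longrightarrow> \<exists>n. parses G n x u"
proof (induction rule: leftmost.induct)
  case (Nt A w x u)
  then obtain n where "parses G n (w @ x) u" by blast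
  from parses_append_split[OF this] obtain n1 n2 u1 u2 where
    "u = u1 @ u2" "parses G n1 w u1" "parses G n2 x u2" by blast
  with parses.Nt[OF Nt.hyps(1)] show ?case by blast
qed (auto intro: parses.intros)

lemma leftmost_iff_parses: "leftmost G x u \<longleftrightarrow> (\<exists>n. parses G n x u)"
  using leftmost_imp_parses[of G x u] parses_imp_leftmost_append[OF _ leftmost.Nil, of G _ x u] by auto

lemma cfg_lang_parses: "cfg_lang G = {u. \<exists>n. parses G n [Nt (start G)] u}"
  by (simp add: cfg_lang_leftmost leftmost_iff_parses)

section \<open>Pumping\<close>

text \<open>No nonterminal repeats along a branch, nor belongs to \<open>S\<close>.\<close>

inductive parses_acyclic ::
  "('n, 'a) cfg \<Rightarrow> 'n set \<Rightarrow> ('n, 'a) symbol list \<Rightarrow> 'a list \<Rightarrow> bool" for G where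
  Nil: "parses_acyclic G S [] []"
| Tm: "parses_acyclic G S x u \<Longrightarrow> parses_acyclic G S (Tm a # x) (a # u)"
| Nt: "\<lbrakk>A \<notin> S; (A, w) \<in> prods G; parses_acyclic G (insert A S) w u; parses_acyclic G S x v\<rbrakk> \<Longrightarrow>
       parses_acyclic G S (Nt A # x) (u @ v)"

inductive_cases parses_acyclic_NilE: "parses_acyclic G S [] u"
inductive_cases parses_acyclic_TmE: "parses_acyclic G S (Tm a # x) u"
inductive_cases parses_acyclic_NtE: "parses_acyclic G S (Nt A # x) u"

text \<open>Entering a right-hand side moves a left-hand nonterminal into \<open>S\<close>, so the
  number of those outside \<open>S\<close> drops; within a form the induction is on its
  length.\<close>

lemma finite_parses_acyclic:
  assumes "finite (prods G)"
  shows "finite {u. parses_acyclic G S x u}"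
proof (induction "card (fst ` prods G - S)" arbitrary: S x rule: less_induct)
  case less
  show ?case
  proof (induction x)
    case Nil
    have "{u. parses_acyclic G S [] u} \<subseteq> {[]}" by (auto elim: parses_acyclic_NilE)
    then show ?case by (rule finite_subset) simp
  next
    case (Cons s x)
    show ?case
    proof (cases s)
      case (Tm a)
      have "{u. parses_acyclic G S (Tm a # x) u} \<subseteq> (#) a ` {u. parses_acyclic G S x u}"
        by (auto elim: parses_acyclic_TmE)
      moreover have "finite ((#) a ` {u. parses_acyclic G S x u})" using Cons by (rule finite_imageI)
      ultimately show ?thesis unfolding Tm by (rule finite_subset)
    next
      case (Nt A)
      let ?W = "{w. A \<notin> S \<and> (A, w) \<in> prods G}"
      let ?U = "\<Union>w\<in>?W. {u. parses_acyclic G (insert A S) w u}"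
      have "?W \<subseteq> snd ` prods G" by force
      then have fin: "finite ?W" using assms finite_subset by blast
      have "finite {u. parses_acyclic G (insert A S) w u}" if "w \<in> ?W" for w
      proof (rule less)
        have "A \<in> fst ` prods G - S" using that by force
        then show "card (fst ` prods G - insert A S) < card (fst ` prods G - S)"
          using assms by (intro psubset_card_mono) auto
      qed
      with fin have "finite ?U" by (rule finite_UN_I)
      with Cons have "finite ((\<lambda>(u, v). u @ v) ` (?U \<times> {v. parses_acyclic G S x v}))" by simp
      moreover have "{u. parses_acyclic G S (Nt A # x) u}
          \<subseteq> (\<lambda>(u, v). u @ v) ` (?U \<times> {v. parses_acyclic G S x v})"
        by (auto elim!: parses_acyclic_NtE)
      ultimately show ?thesis unfolding Nt by (rule rev_finite_subset)
    qed
  qed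
qed

text \<open>A parse forest with one hole, encoded by its effect: \<open>k\<close> counts the
  productions outside the hole, and any parse of \<open>A\<close> may fill it. Contexts then compose
  by chaining implications.\<close>

definition embeds :: "('n, 'a) cfg \<Rightarrow> nat \<Rightarrow> ('n, 'a) symbol list \<Rightarrow> 'n \<Rightarrow> 'a list \<Rightarrow> 'a list \<Rightarrow> bool" where
  "embeds G k x A v z \<longleftrightarrow> (\<forall>m w. parses G m [Nt A] w \<longrightarrow> parses G (m + k) x (v @ w @ z))"

text \<open>The cycle costs \<open>Suc l\<close> productions, so cutting it out makes the parse
  strictly smaller even if \<open>v\<close> and \<open>y\<close> are empty.\<close>

definition pumpable :: "('n, 'a) cfg \<Rightarrow> nat \<Rightarrow> ('n, 'a) symbol list \<Rightarrow> 'a list \<Rightarrow> bool" where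
  "pumpable G n x u \<longleftrightarrow> (\<exists>A m k l p v w y q.
     u = p @ v @ w @ y @ q \<and> n = m + Suc l + k \<and> parses G m [Nt A] w \<and>
     embeds G (Suc l) [Nt A] A v y \<and> embeds G k x A p q)"

lemma pumpableI:
  "\<lbrakk>parses G m [Nt A] w; embeds G (Suc l) [Nt A] A v y; embeds G k x A p q;
    n = m + Suc l + k; u = p @ v @ w @ y @ q\<rbrakk> \<Longrightarrow> pumpable G n x u"
  unfolding pumpable_def by blast

text \<open>In the use below, \<open>S\<close> holds the ancestors of the form, so that a descendant
  from \<open>S\<close> closes a cycle with one of them.\<close>

definition contains :: "('n, 'a) cfg \<Rightarrow> 'n set \<Rightarrow> nat \<Rightarrow> ('n, 'a) symbol list \<Rightarrow> 'a list \<Rightarrow> bool" where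
  "contains G S n x u \<longleftrightarrow> (\<exists>A\<in>S. \<exists>m k v w z.
     u = v @ w @ z \<and> n = m + k \<and> parses G m [Nt A] w \<and> embeds G k x A v z)"

lemma containsI:
  "\<lbrakk>parses G m [Nt A] w; embeds G k x A v z; A \<in> S; n = m + k; u = v @ w @ z\<rbrakk> \<Longrightarrow>
   contains G S n x u"
  unfolding contains_def by blast

lemma parses_sized_append:
  "parses G m x u \<Longrightarrow> parses G n y v \<Longrightarrow> parses G (m + n) (x @ y) (u @ v)"
proof (induction rule: parses.induct)
  case (Nt A w k u n' x v')
  then show ?case using parses.Nt[of A w G k u "n' + n" "x @ y" "v' @ v"] by (simp add: add_ac)
qed (auto intro: parses.intros)

lemma embeds_parent:
  assumes "embeds G k w B v z" "(A, w) \<in> prods G" "parses G n x t"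
  shows "embeds G (Suc (k + n)) (Nt A # x) B v (z @ t)"
  unfolding embeds_def
proof (intro allI impI)
  fix m u assume "parses G m [Nt B] u"
  with assms have "parses G (m + k) w (v @ u @ z)" by (auto simp: embeds_def)
  from parses.Nt[OF assms(2) this assms(3)]
  show "parses G (m + Suc (k + n)) (Nt A # x) (v @ u @ z @ t)" by (simp add: add_ac)
qed

lemma embeds_left:
  assumes "embeds G k x B v z" "parses G n y t"
  shows "embeds G (n + k) (y @ x) B (t @ v) z"
  unfolding embeds_def
proof (intro allI impI)
  fix m u assume "parses G m [Nt B] u"
  with assms have "parses G (m + k) x (v @ u @ z)" by (auto simp: embeds_def)
  from parses_sized_append[OF assms(2) this]
  show "parses G (m + (n + k)) (y @ x) ((t @ v) @ u @ z)" by (simp add: add_ac)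
qed

lemma embeds_right:
  assumes "parses G n x t"
  shows "embeds G n (Nt A # x) A [] t"
  unfolding embeds_def using parses_sized_append[OF _ assms, of _ "[Nt A]"] by simp

lemma pumpable_parent:
  assumes "pumpable G k w u" "(A, w) \<in> prods G" "parses G n x t"
  shows "pumpable G (Suc (k + n)) (Nt A # x) (u @ t)"
proof -
  from assms(1) obtain B m k' l p v w' y q where
    *: "u = p @ v @ w' @ y @ q" "k = m + Suc l + k'" "parses G m [Nt B] w'"
      "embeds G (Suc l) [Nt B] B v y" "embeds G k' w B p q"
    unfolding pumpable_def by blast
  show ?thesis by (rule pumpableI[OF *(3,4) embeds_parent[OF *(5) assms(2,3)]]) (use * in simp_all)
qed

lemma pumpable_left:
  assumes "pumpable G k x u" "parses G n y t"
  shows "pumpable G (n + k) (y @ x) (t @ u)"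
proof -
  from assms(1) obtain B m k' l p v w' y' q where
    *: "u = p @ v @ w' @ y' @ q" "k = m + Suc l + k'" "parses G m [Nt B] w'"
      "embeds G (Suc l) [Nt B] B v y'" "embeds G k' x B p q"
    unfolding pumpable_def by blast
  show ?thesis by (rule pumpableI[OF *(3,4) embeds_left[OF *(5) assms(2)]]) (use * in simp_all)
qed

text \<open>A nonterminal in \<open>S\<close> is a hit by itself. Otherwise its right-hand side is
  examined with \<open>A\<close> added to \<open>S\<close>: a hit on \<open>A\<close> closes a cycle
  here, a hit on another ancestor is passed upwards.\<close>

lemma parses_trichotomy:
  assumes "parses G n x u"
  shows "parses_acyclic G S x u \<or> pumpable G n x u \<or> contains G S n x u"
  using assms
proof (induction arbitrary: S rule: parses.induct)
  case Nil
  then show ?case by (auto intro: parses_acyclic.Nil)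
next
  case (Tm n x u a)
  have a: "parses G 0 [Tm a] [a]" by (auto intro: parses.intros)
  from Tm.IH[of S] show ?case
  proof (elim disjE)
    assume "contains G S n x u"
    then obtain A m k v w z where *: "A \<in> S" "u = v @ w @ z" "n = m + k" "parses G m [Nt A] w"
      "embeds G k x A v z" unfolding contains_def by blast
    from containsI[OF *(4) embeds_left[OF *(5) a] *(1)] * have "contains G S n (Tm a # x) (a # u)" by simp
    then show ?thesis by blast
  qed (use pumpable_left[OF _ a] in \<open>auto intro: parses_acyclic.Tm\<close>)
next
  case (Nt A w k u n x v)
  have A: "parses G (Suc k) [Nt A] u"
    using parses.Nt[OF Nt.hyps(1,2) parses.Nil] by simp
  show ?case
  proof (cases "A \<in> S")
    case True
    from containsI[OF A embeds_right[OF Nt.hyps(3)] this]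
    have "contains G S (Suc (k + n)) (Nt A # x) (u @ v)" by simp
    then show ?thesis by blast
  next
    case False
    consider (pump1) "pumpable G k w u" | (pump2) "pumpable G n x v"
      | (emb1) "contains G (insert A S) k w u" | (emb2) "contains G S n x v"
      | (acyclic) "parses_acyclic G (insert A S) w u" "parses_acyclic G S x v"
      using Nt.IH(1)[of "insert A S"] Nt.IH(2)[of S] by blast
    then show ?thesis
    proof cases
      case pump1
      from pumpable_parent[OF this Nt.hyps(1,3)] show ?thesis by blast
    next
      case pump2
      from pumpable_left[OF this A] show ?thesis by simp
    next
      case emb1
      then obtain B m k' p w' q where *: "B \<in> insert A S" "u = p @ w' @ q" "k = m + k'"
        "parses G m [Nt B] w'" "embeds G k' w B p q" unfolding contains_def by blast
      show ?thesis
      proof (cases "B = A")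
        case True
        \<comment> \<open>The production applied at this node supplies the \<open>Suc\<close> that
          \<open>pumpable\<close> demands of the cycle.\<close>
        have "embeds G (Suc k') [Nt A] A p q"
          using embeds_parent[OF *(5) Nt.hyps(1) parses.Nil] True by simp
        then have "pumpable G (Suc (k + n)) (Nt A # x) (u @ v)"
          by (rule pumpableI[OF *(4)[unfolded True] _ embeds_right[OF Nt.hyps(3)]]) (use * in simp_all)
        then show ?thesis by blast
      next
        case False
        have "contains G S (Suc (k + n)) (Nt A # x) (u @ v)"
          by (rule containsI[OF *(4) embeds_parent[OF *(5) Nt.hyps(1,3)]]) (use * False in simp_all)
        then show ?thesis by blast
      qed
    next
      case emb2
      then obtain B m k' p w' q where *: "B \<in> S" "v = p @ w' @ q" "n = m + k'"
        "parses G m [Nt B] w'" "embeds G k' x B p q" unfolding contains_def by blast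
      have "contains G S (Suc (k + n)) (Nt A # x) (u @ v)"
        by (rule containsI[OF *(4) embeds_left[OF *(5) A, simplified]]) (use * in simp_all)
      then show ?thesis by blast
    next
      case acyclic
      then show ?thesis using False Nt.hyps(1) by (auto intro: parses_acyclic.Nt)
    qed
  qed
qed

abbreviation repeat :: "nat \<Rightarrow> 'a list \<Rightarrow> 'a list" where
  "repeat i v \<equiv> concat (replicate i v)"

lemma embeds_repeat:
  assumes "embeds G k [Nt A] A v y" "parses G m [Nt A] w"
  shows "\<exists>n. parses G n [Nt A] (repeat i v @ w @ repeat i y)"
proof (induction i)
  case 0
  show ?case using assms(2) by auto
next
  case (Suc i)
  then obtain n where "parses G n [Nt A] (repeat i v @ w @ repeat i y)" by blast
  then have "parses G (n + k) [Nt A] (v @ (repeat i v @ w @ repeat i y) @ y)"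
    using assms(1) unfolding embeds_def by blast
  moreover have "repeat i y @ y = y @ repeat i y" by (induction i) auto
  ultimately show ?case by (metis append.assoc concat.simps(2) replicate_Suc)
qed

text \<open>A parse with the fewest productions cannot contain a cycle \<open>A \<Rightarrow>\<^sup>+ A\<close>, so a repeated nonterminal on
  a branch of it yields a nonempty pump. Without repetition only finitely many words are parsed.\<close>

lemma context_free_pumping:
  assumes "L \<in> cf_langs"
  obtains B where "finite B"
    "\<And>u. u \<in> L \<Longrightarrow> u \<notin> B \<Longrightarrow>
      \<exists>p v w y q. u = p @ v @ w @ y @ q \<and> v @ y \<noteq> [] \<and>
        (\<forall>i. p @ repeat i v @ w @ repeat i y @ q \<in> L)"
proof -
  from assms obtain G :: "(nat, 'a) cfg" where G: "is_cfg G" and L: "L = cfg_lang G"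
    by (auto simp: cf_langs_def)
  let ?S = "[Nt (start G)]"
  have fin: "finite {u. parses_acyclic G {} ?S u}"
    using G by (intro finite_parses_acyclic) (simp add: is_cfg_def)
  show thesis
  proof (rule that[OF fin])
    fix u assume "u \<in> L" and nac: "u \<notin> {u. parses_acyclic G {} ?S u}"
    then have ex: "\<exists>n. parses G n ?S u" by (simp add: L cfg_lang_parses)
    define n where "n = (LEAST n. parses G n ?S u)"
    have n: "parses G n ?S u" unfolding n_def by (rule LeastI_ex[OF ex])
    have min: "n \<le> n'" if "parses G n' ?S u" for n' unfolding n_def using that by (rule Least_le)
    from parses_trichotomy[OF n, of "{}"] nac have "pumpable G n ?S u" by (auto simp: contains_def)
    then obtain A m k l p v w y q where
      *: "u = p @ v @ w @ y @ q" "n = m + Suc l + k" "parses G m [Nt A] w"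
        "embeds G (Suc l) [Nt A] A v y" "embeds G k ?S A p q"
      unfolding pumpable_def by blast
    have "v @ y \<noteq> []"
    proof
      assume "v @ y = []"
      with * have "parses G (m + k) ?S u" by (auto simp: embeds_def)
      from min[OF this] *(2) show False by simp
    qed
    moreover have "p @ repeat i v @ w @ repeat i y @ q \<in> L" for i
    proof -
      from embeds_repeat[OF *(4,3), of i] *(5)
      have "\<exists>n. parses G n ?S (p @ (repeat i v @ w @ repeat i y) @ q)"
        unfolding embeds_def by blast
      then show ?thesis by (simp add: L cfg_lang_parses)
    qed
    ultimately show "\<exists>p v w y q. u = p @ v @ w @ y @ q \<and> v @ y \<noteq> [] \<and>
        (\<forall>i. p @ repeat i v @ w @ repeat i y @ q \<in> L)"
      using *(1) by blast
  qed
qed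

section \<open>Petri nets\<close>

lemma label_word_simps [simp]:
  "label_word lam [] = []"
  "label_word lam (t # ts) = (case lam t of None \<Rightarrow> [] | Some a \<Rightarrow> [a]) @ label_word lam ts"
  by (simp_all add: label_word_def)

lemma label_word_append [simp]: "label_word lam (x @ y) = label_word lam x @ label_word lam y"
  by (simp add: label_word_def)

text \<open>Silent transitions at the border may fall on either side; some cut exists, which is all
  that the exchange argument uses.\<close>

lemma label_word_append_split:
  "label_word lam ts = u @ v \<Longrightarrow> \<exists>x y. ts = x @ y \<and> label_word lam x = u \<and> label_word lam y = v"
proof (induction ts arbitrary: u)
  case (Cons t ts)
  show ?case
  proof (cases "u = []")
    case True
    with Cons.prems show ?thesis by force
  next
    case False
    show ?thesis
    proof (cases "lam t")
      case None
      with Cons obtain x y where "ts = x @ y" "label_word lam x = u" "label_word lam y = v" by force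
      with None show ?thesis by (metis append_Cons label_word_simps(2) option.simps(4) self_append_conv2)
    next
      case (Some a)
      with False Cons.prems obtain u' where "u = a # u'" "label_word lam ts = u' @ v"
        by (cases u) auto
      moreover from Cons.IH[OF this(2)] obtain x y where
        "ts = x @ y" "label_word lam x = u'" "label_word lam y = v" by blast
      ultimately have "t # ts = (t # x) @ y" "label_word lam (t # x) = u" "label_word lam y = v"
        using Some by simp_all
      then show ?thesis by blast
    qed
  qed
qed simp

inductive_cases pn_run_NilE: "pn_run N m [] m'"
inductive_cases pn_run_ConsE: "pn_run N m (t # \<sigma>) m'"

lemma pn_run_append:
  "pn_run N m (x @ y) m'' \<longleftrightarrow> (\<exists>m'. pn_run N m x m' \<and> pn_run N m' y m'')"
proof (induction x arbitrary: m)
  case Nil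
  then show ?case by (auto intro: pn_run.Nil elim: pn_run_NilE)
next
  case (Cons t x)
  then show ?case by (auto 4 4 intro: pn_run.Cons elim!: pn_run_ConsE)
qed

lemma pn_run_vecs:
  "pn_run N m \<sigma> m' \<Longrightarrow> is_petri_net N \<Longrightarrow> m \<in> vecs (pn_places N) \<Longrightarrow> m' \<in> vecs (pn_places N)"
  by (induction rule: pn_run.induct) (auto simp: is_petri_net_def vecs_def)

lemma pn_run_mono:
  "pn_run N m \<sigma> m' \<Longrightarrow> m \<le> k \<Longrightarrow> \<exists>k'. pn_run N k \<sigma> k' \<and> m' \<le> k'"
proof (induction arbitrary: k rule: pn_run.induct)
  case (Nil m)
  then show ?case by (blast intro: pn_run.Nil)
next
  case (Cons t m \<sigma> m')
  from Cons.prems have "(\<lambda>p. m p - pn_pre N t p + pn_post N t p) \<le> (\<lambda>p. k p - pn_pre N t p + pn_post N t p)"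
    by (auto simp: le_fun_def intro: diff_le_mono)
  from Cons.IH[OF this] obtain k' where
    "pn_run N (\<lambda>p. k p - pn_pre N t p + pn_post N t p) \<sigma> k'" "m' \<le> k'" by blast
  moreover from Cons.hyps(2) Cons.prems have "pn_pre N t \<le> k" by (rule order_trans)
  ultimately show ?case using pn_run.Cons[OF Cons.hyps(1)] by blast
qed

lemma pn_cov_lang_step:
  assumes "t \<in> pn_trans N" "pn_pre N t \<le> m"
    and "u \<in> pn_cov_lang N lam (\<lambda>p. m p - pn_pre N t p + pn_post N t p) F"
  shows "(case lam t of None \<Rightarrow> [] | Some a \<Rightarrow> [a]) @ u \<in> pn_cov_lang N lam m F"
proof -
  from assms(3) obtain \<sigma> m' where \<sigma>: "u = label_word lam \<sigma>" "\<exists>k\<in>F. k \<le> m'"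
    "pn_run N (\<lambda>p. m p - pn_pre N t p + pn_post N t p) \<sigma> m'"
    by (auto simp: pn_cov_lang_def)
  from pn_run.Cons[OF assms(1,2) \<sigma>(3)] \<sigma>(2) have "label_word lam (t # \<sigma>) \<in> pn_cov_lang N lam m F"
    unfolding pn_cov_lang_def by blast
  with \<sigma>(1) show ?thesis by simp
qed

section \<open>Dickson's lemma and the exchange property of Petri net languages\<close>

lemma nat_seq_mono_subseq:
  fixes g :: "nat \<Rightarrow> nat"
  shows "\<exists>r :: nat \<Rightarrow> nat. strict_mono r \<and> mono (g \<circ> r)"
proof -
  \<comment> \<open>The minimum of \<open>g\<close> beyond \<open>N\<close> is attained. Iterating
    this choice gives nondecreasing values, since the next position also lies beyond the same
    \<open>N\<close>.\<close>
  have "\<exists>n>N. \<forall>k>N. g n \<le> g k" for N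
  proof -
    have "\<exists>x. x > N \<and> (\<forall>y. y > N \<longrightarrow> g x \<le> g y)"
      by (rule ex_has_least_nat[of _ "Suc N"]) simp
    then show ?thesis by blast
  qed
  then obtain f where f: "f N > N" "\<And>k. k > N \<Longrightarrow> g (f N) \<le> g k" for N by metis
  define r where "r n = (f ^^ Suc n) 0" for n
  have "strict_mono r" unfolding strict_mono_Suc_iff r_def using f(1) by simp
  moreover have "g (r n) \<le> g (r (Suc n))" for n
  proof -
    have "r (Suc n) > (f ^^ n) 0" using f(1) less_trans unfolding r_def by (metis funpow.simps(2) o_apply)
    then show ?thesis using f(2) unfolding r_def by simp
  qed
  then have "mono (g \<circ> r)" by (simp add: mono_iff_le_Suc)
  ultimately show ?thesis by blast
qed

text \<open>One coordinate at a time: a further subsequence stays monotone in the coordinates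
  treated earlier.\<close>

lemma dickson_subseq:
  fixes g :: "nat \<Rightarrow> 'p \<Rightarrow> nat"
  assumes "finite P"
  shows "\<exists>r :: nat \<Rightarrow> nat. strict_mono r \<and> (\<forall>p\<in>P. mono (\<lambda>n. g (r n) p))"
  using assms
proof (induction P)
  case empty
  have "strict_mono (id :: nat \<Rightarrow> nat)" by (simp add: strict_mono_def)
  then show ?case by blast
next
  case (insert p P)
  then obtain r :: "nat \<Rightarrow> nat" where r: "strict_mono r" "\<forall>p\<in>P. mono (\<lambda>n. g (r n) p)" by blast
  from nat_seq_mono_subseq[of "\<lambda>n. g (r n) p"] obtain r' :: "nat \<Rightarrow> nat" where
    r': "strict_mono r'" "mono ((\<lambda>n. g (r n) p) \<circ> r')" by blast
  have "mono (\<lambda>n. g (r (r' n)) p')" if "p' \<in> P" for p'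
    using r(2) that r'(1) by (meson monoI monoD strict_mono_less_eq)
  with r r' show ?case
    by (intro exI[of _ "r \<circ> r'"]) (auto simp: strict_mono_def comp_def)
qed

lemma dickson:
  fixes g :: "nat \<Rightarrow> 'p \<Rightarrow> nat"
  assumes "finite P" "\<And>n. g n \<in> vecs P"
  shows "\<exists>i j. i < j \<and> g i \<le> g j"
proof -
  from dickson_subseq[OF assms(1), of g] obtain r :: "nat \<Rightarrow> nat" where
    r: "strict_mono r" "\<forall>p\<in>P. mono (\<lambda>n. g (r n) p)" by blast
  have "g (r 0) p \<le> g (r 1) p" for p
  proof (cases "p \<in> P")
    case True
    then show ?thesis using r(2) by (auto dest!: bspec monoD[of _ 0 1])
  next
    case False
    then show ?thesis using assms(2)[of "r 0"] by (auto simp: vecs_def)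
  qed
  then have "g (r 0) \<le> g (r 1)" by (simp add: le_fun_def)
  moreover have "r 0 < r 1" using r(1) by (simp add: strict_mono_def)
  ultimately show ?thesis by blast
qed

text \<open>Each accepting run is cut where \<open>u n\<close> ends. Two of the markings at the cuts
  are comparable, and by monotonicity the larger one can continue with the second half of the other
  run.\<close>

lemma pn_cov_lang_exchange:
  assumes "L \<in> pn_cov_langs" and "\<And>n :: nat. u n @ v n \<in> L"
  shows "\<exists>i j. i < j \<and> u j @ v i \<in> L"
proof -
  from assms(1) obtain N :: "(nat, nat) petri_net" and \<Sigma> lam m0 F where
    N: "is_petri_net N" "m0 \<in> vecs (pn_places N)" and L: "L = pn_cov_lang N lam m0 F"
    unfolding pn_cov_langs_def by blast
  have "\<exists>x y m m'. pn_run N m0 x m \<and> pn_run N m y m' \<and> (\<exists>mf\<in>F. mf \<le> m') \<and>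
      label_word lam x = u n \<and> label_word lam y = v n" for n
  proof -
    from assms(2)[of n] obtain \<sigma> m' where
      "label_word lam \<sigma> = u n @ v n" "pn_run N m0 \<sigma> m'" "\<exists>mf\<in>F. mf \<le> m'"
      unfolding L pn_cov_lang_def by force
    moreover from label_word_append_split[OF this(1)] obtain x y where
      "\<sigma> = x @ y" "label_word lam x = u n" "label_word lam y = v n" by blast
    moreover from calculation obtain m where "pn_run N m0 x m" "pn_run N m y m'"
      using pn_run_append[of N m0 x y m'] by auto
    ultimately show ?thesis by blast
  qed
  then obtain x y m m' where *: "\<And>n. pn_run N m0 (x n) (m n)" "\<And>n. pn_run N (m n) (y n) (m' n)"
    "\<And>n. \<exists>mf\<in>F. mf \<le> m' n" "\<And>n. label_word lam (x n) = u n" "\<And>n. label_word lam (y n) = v n"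
    by metis
  have "m n \<in> vecs (pn_places N)" for n using pn_run_vecs[OF *(1) N] .
  moreover have "finite (pn_places N)" using N by (simp add: is_petri_net_def)
  ultimately obtain i j where ij: "i < j" "m i \<le> m j" using dickson by blast
  from pn_run_mono[OF *(2) ij(2)] obtain k' where k': "pn_run N (m j) (y i) k'" "m' i \<le> k'" by blast
  have "pn_run N m0 (x j @ y i) k'" unfolding pn_run_append using *(1) k'(1) by blast
  moreover have "\<exists>mf\<in>F. mf \<le> k'" using *(3) k'(2) order_trans by blast
  ultimately have "u j @ v i \<in> L" unfolding L pn_cov_lang_def using *(4,5)
    by (auto intro!: exI[of _ "x j @ y i"])
  with ij show ?thesis by blast
qed

section \<open>Recursive Petri nets\<close>

lemma fire_map_transitions:
  assumes "fire N H s v t s'"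
    and "t \<in> Tel N \<Longrightarrow> h t \<in> Tel N'" "t \<in> Tab N \<Longrightarrow> h t \<in> Tab N'" "t \<in> Tcut N \<Longrightarrow> h t \<in> Tcut N'"
    and "Wminus N' (h t) = Wminus N t" "Wplus N' (h t) = Wplus N t" "Omega N' (h t) = Omega N t"
  shows "fire N' H s v (h t) s'"
  using assms(1)
proof cases
  case elementary
  then show ?thesis using assms fire.elementary[of v s "h t" N' H] by simp
next
  case (abstract w)
  then show ?thesis using assms fire.abstract[of v s "h t" N' w H] by simp
next
  case cut_root
  then show ?thesis using assms fire.cut_root[of v s "h t" N' H] by simp
next
  case (cut_inner u)
  then show ?thesis using assms fire.cut_inner[of v s "h t" N' u H] by simp
qed

lemma fire_transition: "fire N H s v t s' \<Longrightarrow> t \<in> transitions N"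
  by (auto elim!: fire.cases simp: transitions_def)

lemma run_map_transitions:
  assumes "run N H s \<sigma> s'"
    and "\<And>t. t \<in> Tel N \<Longrightarrow> h t \<in> Tel N'" "\<And>t. t \<in> Tab N \<Longrightarrow> h t \<in> Tab N'"
      "\<And>t. t \<in> Tcut N \<Longrightarrow> h t \<in> Tcut N'"
    and "\<And>t. t \<in> transitions N \<Longrightarrow>
      Wminus N' (h t) = Wminus N t \<and> Wplus N' (h t) = Wplus N t \<and> Omega N' (h t) = Omega N t"
  shows "run N' H s (map (apsnd h) \<sigma>) s'"
  using assms(1)
proof (induction rule: run.induct)
  case (Nil H s)
  show ?case by (simp add: run.Nil)
next
  case (Cons H s v t s' \<sigma> s'')
  have "fire N' H s v (h t) s'"
    using assms(2-5) fire_transition[OF Cons.hyps(1)] by (intro fire_map_transitions[OF Cons.hyps(1)]) auto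
  then show ?case using Cons.IH by (simp add: run.Cons)
qed

lemma run_transitions: "run N H s \<sigma> s' \<Longrightarrow> set (map snd \<sigma>) \<subseteq> transitions N"
  by (induction rule: run.induct) (auto dest: fire_transition)

lemma label_word_map: "label_word lam (map h ts) = label_word (lam \<circ> h) ts"
  by (simp add: label_word_def comp_def)

lemma label_word_cong: "(\<And>t. t \<in> set ts \<Longrightarrow> lam t = lam' t) \<Longrightarrow> label_word lam ts = label_word lam' ts"
  by (simp add: label_word_def cong: map_cong)

text \<open>The family only admits natural numbers as transitions, whereas the simulating net is
  clearer with a datatype of moves; renaming its finitely many transitions bridges the two.\<close>

lemma rpn_cov_langsI:
  fixes N :: "(nat, 't) rpn"
  assumes N: "is_rpn N" and "is_state N s0" "finite Sf" "\<forall>sf\<in>Sf. is_state N sf"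
  shows "rpn_cov_lang N lam s0 Sf \<in> rpn_cov_langs"
proof -
  have fin: "finite (transitions N)" using N by (simp add: is_rpn_def)
  then obtain f :: "'t \<Rightarrow> nat" where f: "inj_on f (transitions N)"
    using finite_imp_inj_to_nat_seg by blast
  define g where "g = the_inv_into (transitions N) f"
  have g: "g (f t) = t" if "t \<in> transitions N" for t
    using the_inv_into_f_f[OF f that] by (simp add: g_def)
  define N' :: "(nat, nat) rpn" where
    "N' = \<lparr>places = places N, Tel = f ` Tel N, Tab = f ` Tab N, Tcut = f ` Tcut N,
      Wminus = Wminus N \<circ> g, Wplus = Wplus N \<circ> g, Omega = Omega N \<circ> g\<rparr>"
  have T': "transitions N' = f ` transitions N" by (auto simp: transitions_def N'_def)
  have gT: "t \<in> Tel N \<Longrightarrow> g (f t) = t" "t \<in> Tab N \<Longrightarrow> g (f t) = t" "t \<in> Tcut N \<Longrightarrow> g (f t) = t" for t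
    using g by (auto simp: transitions_def)
  have disj: "f ` A \<inter> f ` B = {}" if "A \<inter> B = {}" "A \<subseteq> transitions N" "B \<subseteq> transitions N" for A B
    using inj_on_image_Int[OF f that(2,3)] that(1) by auto
  have "is_rpn N'"
    unfolding is_rpn_def
  proof (intro conjI)
    show "finite (transitions N')" using fin T' by simp
    show "Tel N' \<inter> Tab N' = {}" "Tel N' \<inter> Tcut N' = {}" "Tab N' \<inter> Tcut N' = {}"
      using N disj by (auto simp: N'_def is_rpn_def transitions_def)
    show "\<forall>t\<in>transitions N'. Wminus N' t \<in> vecs (places N')"
      using N by (auto simp: T' g) (simp add: N'_def is_rpn_def g)
  qed (use N gT in \<open>auto simp: N'_def is_rpn_def\<close>)
  \<comment> \<open>Finitely many transitions use finitely many labels, so \<open>lam\<close> may be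
    arbitrary.\<close>
  moreover have "is_labelling (transitions N') (\<Union>t\<in>transitions N'. set_option (lam (g t))) (lam \<circ> g)"
    using fin T' by (fastforce simp: is_labelling_def)
  moreover have "is_state N' s = is_state N s" for s :: "nat state"
  proof -
    have "Wplus N' ` Tab N' = Wplus N ` Tab N"
      using gT(2) by (simp add: N'_def image_image cong: image_cong)
    then show ?thesis by (simp add: is_state_def N'_def)
  qed
  moreover have "rpn_cov_lang N' (lam \<circ> g) s0 Sf = rpn_cov_lang N lam s0 Sf"
  proof (intro equalityI subsetI)
    fix u assume "u \<in> rpn_cov_lang N' (lam \<circ> g) s0 Sf"
    then obtain \<sigma> s where *: "u = label_word (lam \<circ> g) (map snd \<sigma>)" "run N' {} s0 \<sigma> s" "\<exists>sf\<in>Sf. sf \<preceq> s"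
      by (auto simp: rpn_cov_lang_def)
    have "run N {} s0 (map (apsnd g) \<sigma>) s"
      by (rule run_map_transitions[OF *(2)]) (auto simp: N'_def gT)
    moreover have "u = label_word lam (map snd (map (apsnd g) \<sigma>))"
      using label_word_map[of lam g "map snd \<sigma>"] * by (simp add: comp_def)
    ultimately show "u \<in> rpn_cov_lang N lam s0 Sf" using *(3) unfolding rpn_cov_lang_def by blast
  next
    fix u assume "u \<in> rpn_cov_lang N lam s0 Sf"
    then obtain \<sigma> s where *: "u = label_word lam (map snd \<sigma>)" "run N {} s0 \<sigma> s" "\<exists>sf\<in>Sf. sf \<preceq> s"
      by (auto simp: rpn_cov_lang_def)
    have "run N' {} s0 (map (apsnd f) \<sigma>) s"
      by (rule run_map_transitions[OF *(2)]) (auto simp: N'_def g)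
    moreover have "u = label_word (lam \<circ> g) (map snd (map (apsnd f) \<sigma>))"
    proof -
      have "u = label_word (lam \<circ> g \<circ> f) (map snd \<sigma>)"
        unfolding *(1) using run_transitions[OF *(2)] g by (intro label_word_cong) auto
      then show ?thesis using label_word_map[of "lam \<circ> g" f "map snd \<sigma>"] by (simp add: comp_def)
    qed
    ultimately show "u \<in> rpn_cov_lang N' (lam \<circ> g) s0 Sf" using *(3) unfolding rpn_cov_lang_def by blast
  qed
  ultimately show ?thesis unfolding rpn_cov_langs_def using assms(2-4) by blast
qed

section \<open>Concatenating a context-free and a Petri net language\<close>

type_synonym 'a form = "(nat, 'a) symbol list"

text \<open>The first three are moves of a stack machine, realised by elementary, abstract and cut
  transitions; \<open>Pn\<close> copies a Petri net transition. In \<open>Call A y w\<close> the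
  caller resumes at \<open>y\<close> and the child starts with \<open>w\<close>.\<close>

datatype 'a trans = Read 'a "'a form" | Call nat "'a form" "'a form" | Return | Pn nat

text \<open>The list runs from the parent of \<open>v\<close> to the bottom of the stack, so each
  entry is the parent of its predecessor.\<close>

fun links :: "thread \<Rightarrow> (thread \<times> 'f) list \<Rightarrow> ((thread \<times> thread) \<times> 'f) list" where
  "links v [] = []"
| "links v ((w, y) # fs) = ((w, v), y) # links w fs"

lemma links_source: "((a, b), y) \<in> set (links v fs) \<Longrightarrow> a \<in> fst ` set fs"
  by (induction v fs rule: links.induct) auto

lemma links_target: "((a, b), y) \<in> set (links v fs) \<Longrightarrow> b = v \<or> b \<in> fst ` set fs"
  by (induction v fs rule: links.induct) auto

text \<open>Consequently an empty form is never that of the root, so \<open>Return\<close> never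
  destroys the whole tree, and \<open>[Nt Z]\<close> can only be the form of the root.\<close>

fun ends_at_bottom :: "nat \<Rightarrow> 'a form \<Rightarrow> 'a form list \<Rightarrow> bool" where
  "ends_at_bottom Z x [] \<longleftrightarrow> (\<exists>y. x = y @ [Nt Z])"
| "ends_at_bottom Z x (y # ys) \<longleftrightarrow> Nt Z \<notin> set x \<and> ends_at_bottom Z y ys"

lemma ends_at_bottom_concat: "ends_at_bottom Z x ys \<Longrightarrow> \<exists>y. concat (x # ys) = y @ [Nt Z]"
proof (induction Z x ys rule: ends_at_bottom.induct)
  case (2 Z x y ys)
  then obtain z where "concat (y # ys) = z @ [Nt Z]" by auto
  then have "concat (x # y # ys) = (x @ z) @ [Nt Z]" by simp
  then show ?case by blast
qed simp

lemma ends_at_bottom_tail: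
  "ends_at_bottom Z (a # x) ys \<Longrightarrow> a \<noteq> Nt Z \<Longrightarrow> ends_at_bottom Z x ys"
  by (cases ys) (auto simp: Cons_eq_append_conv)

text \<open>The root carries the Petri net marking throughout; its place \<open>[Nt Z]\<close>, for an unused
  nonterminal \<open>Z\<close>, enables the Petri net transitions once the derivation is complete.\<close>

locale cfg_then_pn =
  fixes G :: "(nat, 'a) cfg" and M :: "(nat, nat) petri_net" and lam :: "nat \<Rightarrow> 'a option"
    and m0 :: "nat \<Rightarrow> nat" and F :: "(nat \<Rightarrow> nat) set" and Z :: nat
    and forms :: "'a form set" and pl :: "'a form \<Rightarrow> nat"
  assumes G: "is_cfg G" and M: "is_petri_net M"
    and m0: "m0 \<in> vecs (pn_places M)" and F: "finite F" "F \<subseteq> vecs (pn_places M)"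
    and Z: "Z \<notin> nonterms G"
    and forms: "finite forms" "[] \<in> forms" "[Nt (start G), Nt Z] \<in> forms" "snd ` prods G \<subseteq> forms"
    and forms_tail: "a # x \<in> forms \<Longrightarrow> x \<in> forms"
    and pl: "inj_on pl forms" "pl ` forms \<inter> pn_places M = {}"
begin

definition token :: "'a form \<Rightarrow> nat \<Rightarrow> nat" where
  "token x = (\<lambda>p. if p = pl x then 1 else 0)"

text \<open>A call moves the resumption form onto the edge label, so a suspended thread has no form
  token and cannot fire until its child returns. In \<open>Pn\<close> the marker is consumed and
  restored, which only tests for it.\<close>

definition net :: "(nat, 'a trans) rpn" where
  "net = \<lparr>
     places = pn_places M \<union> pl ` forms,
     Tel = {Read a y | a y. Tm a # y \<in> forms} \<union> Pn ` pn_trans M,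
     Tab = {Call A y w | A y w. Nt A # y \<in> forms \<and> (A, w) \<in> prods G},
     Tcut = {Return},
     Wminus = (\<lambda>t. case t of Read a y \<Rightarrow> token (Tm a # y) | Call A y w \<Rightarrow> token (Nt A # y)
       | Return \<Rightarrow> token [] | Pn t \<Rightarrow> (\<lambda>p. pn_pre M t p + token [Nt Z] p)),
     Wplus = (\<lambda>t. case t of Read a y \<Rightarrow> token y | Call A y w \<Rightarrow> token y
       | Return \<Rightarrow> token [] | Pn t \<Rightarrow> (\<lambda>p. pn_post M t p + token [Nt Z] p)),
     Omega = (\<lambda>t. case t of Call A y w \<Rightarrow> token w | _ \<Rightarrow> token [])\<rparr>"

definition lab :: "'a trans \<Rightarrow> 'a option" where
  "lab t = (case t of Read a y \<Rightarrow> Some a | Pn t \<Rightarrow> lam t | _ \<Rightarrow> None)"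

definition single :: "(nat \<Rightarrow> nat) \<Rightarrow> nat state" where
  "single m = \<lparr>verts = {0}, edges = {}, marking = (\<lambda>_. m), elabel = (\<lambda>_ _. 0)\<rparr>"

definition init :: "nat state" where
  "init = single (\<lambda>p. token [Nt (start G), Nt Z] p + m0 p)"

definition finals :: "nat state set" where
  "finals = (\<lambda>m. single (\<lambda>p. token [Nt Z] p + m p)) ` F"

text \<open>The live threads form a chain from the root \<open>0\<close> to the active thread \<open>v\<close>, whose form \<open>x\<close> is
  still to be derived; each suspended thread in \<open>fs\<close> is paired with the form at which it resumes.\<close>

definition config :: "nat state \<Rightarrow> thread \<Rightarrow> 'a form \<Rightarrow> (thread \<times> 'a form) list \<Rightarrow> (nat \<Rightarrow> nat) \<Rightarrow> bool" where
  "config s v x fs m \<longleftrightarrow>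
     distinct (v # map fst fs) \<and> last (v # map fst fs) = 0 \<and>
     verts s = insert v (fst ` set fs) \<and> edges s = fst ` set (links v fs) \<and>
     (\<forall>(e, y)\<in>set (links v fs). elabel s e = token y) \<and>
     (\<forall>z\<in>verts s. marking s z = (\<lambda>p. (if z = v then token x p else 0) + (if z = 0 then m p else 0))) \<and>
     ends_at_bottom Z x (map snd fs) \<and> x \<in> forms \<and> snd ` set fs \<subseteq> forms \<and> m \<in> vecs (pn_places M)"

lemma bottom_form: "[Nt Z] \<in> forms"
  using forms(3) forms_tail by blast

lemma prods_no_bottom: "(A, w) \<in> prods G \<Longrightarrow> A \<noteq> Z \<and> Nt Z \<notin> set w"
  using G Z by (fastforce simp: is_cfg_def)

lemma config_finite: "config s v x fs m \<Longrightarrow> finite (verts s)"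
  by (simp add: config_def)

lemma config_root: "config s v x fs m \<Longrightarrow> 0 \<in> verts s"
  unfolding config_def by (metis last_in_set list.set_map list.simps(15) neq_Nil_conv)

lemma config_read:
  assumes "config s v (Tm a # y) fs m"
  shows "config (s\<lparr>marking := (marking s)(v := \<lambda>p. marking s v p - token (Tm a # y) p + token y p)\<rparr>)
    v y fs m"
  using assms forms_tail by (auto simp: config_def fun_eq_iff dest: ends_at_bottom_tail)

lemma config_call:
  assumes c: "config s v (Nt A # y) fs m" and p: "(A, w) \<in> prods G" and z: "z \<notin> verts s"
  shows "config \<lparr>verts = insert z (verts s), edges = insert (v, z) (edges s),
      marking = (marking s)(v := \<lambda>p. marking s v p - token (Nt A # y) p, z := token w),
      elabel = (elabel s)((v, z) := token y)\<rparr> z w ((v, y) # fs) m"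
proof -
  \<comment> \<open>Initialising the marking of the child must not overwrite the Petri net marking
    at the root.\<close>
  have "z \<noteq> 0" using z config_root[OF c] by metis
  moreover have "w \<in> forms" using p forms(4) by force
  moreover have "ends_at_bottom Z w (y # map snd fs)"
    using prods_no_bottom[OF p] c by (auto simp: config_def dest: ends_at_bottom_tail)
  moreover have "b \<noteq> z" if "((a, b), y') \<in> set (links v fs)" for a b y'
    using links_target[OF that] z c by (auto simp: config_def)
  then have "\<forall>(e, y')\<in>set (links v fs). ((elabel s)((v, z) := token y)) e = token y'"
    using c by (fastforce simp: config_def)
  moreover have "z \<noteq> v" using z c by (auto simp: config_def)
  moreover have "\<forall>z'\<in>verts s. ((marking s)(v := \<lambda>p. marking s v p - token (Nt A # y) p)) z'
      = (\<lambda>p. if z' = 0 then m p else 0)"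
    using c by (auto simp: config_def)
  ultimately show ?thesis
    using c z forms_tail[of "Nt A" y] by (auto simp: config_def)
qed

lemma config_subtree:
  assumes "config s v x fs m"
  shows "subtree s v = {v}"
proof -
  have no: "(v, b) \<notin> edges s" for b
    using assms by (auto simp: config_def dest: links_source)
  have "w = v" if "(v, w) \<in> (edges s)\<^sup>*" for w
    using that no by (auto elim: converse_rtranclE)
  then show ?thesis by (auto simp: subtree_def)
qed

lemma config_return:
  assumes c: "config s v [] ((z, y) # fs) m"
  shows "config (s\<lparr>verts := verts s - subtree s v,
      edges := edges s \<inter> ((- subtree s v) \<times> (- subtree s v)),
      marking := (marking s)(z := \<lambda>p. marking s z p + elabel s (z, v) p)\<rparr>) z y fs m"
proof -
  have "a \<noteq> v \<and> b \<noteq> v" if "((a, b), y') \<in> set (links z fs)" for a b y'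
    using links_source[OF that] links_target[OF that] c by (auto simp: config_def)
  then have "fst ` set (links z fs) \<subseteq> (- {v}) \<times> (- {v})" by fastforce
  then have "edges s \<inter> ((- {v}) \<times> (- {v})) = fst ` set (links z fs)"
    using c by (auto simp: config_def)
  moreover have "elabel s (z, v) = token y" using c by (simp add: config_def)
  ultimately show ?thesis
    unfolding config_subtree[OF c] using c by (auto simp: config_def fun_eq_iff)
qed

lemma config_pn:
  assumes c: "config s v [Nt Z] [] m" and t: "t \<in> pn_trans M" and e: "pn_pre M t \<le> m"
  shows "config (s\<lparr>marking := (marking s)(v := \<lambda>p. marking s v p - (pn_pre M t p + token [Nt Z] p)
      + (pn_post M t p + token [Nt Z] p))\<rparr>) v [Nt Z] [] (\<lambda>p. m p - pn_pre M t p + pn_post M t p)"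
proof -
  have "(\<lambda>p. m p - pn_pre M t p + pn_post M t p) \<in> vecs (pn_places M)"
    using c t M by (auto simp: config_def vecs_def is_petri_net_def)
  moreover have "marking s v p - (pn_pre M t p + token [Nt Z] p) + (pn_post M t p + token [Nt Z] p)
      = token [Nt Z] p + (m p - pn_pre M t p + pn_post M t p)" for p
    using c le_funD[OF e, of p] by (simp add: config_def)
  ultimately show ?thesis using c by (simp add: config_def ac_simps)
qed

text \<open>The Petri net marking vanishes on places of forms, and only the active thread has a form
  token; hence the active thread and its form determine which moves are possible.\<close>

lemma token_le_marking:
  assumes c: "config s v x fs m" and "z \<in> verts s" "y \<in> forms" "token y \<le> marking s z"
  shows "z = v \<and> y = x"
proof -
  have "pl y \<notin> pn_places M" using pl(2) \<open>y \<in> forms\<close> by blast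
  then have "m (pl y) = 0" using c by (simp add: config_def vecs_def)
  moreover have "1 \<le> marking s z (pl y)"
    using assms(4) by (auto simp: le_fun_def token_def dest!: spec[of _ "pl y"])
  ultimately have "z = v" "pl y = pl x"
    using c assms(2) by (auto simp: config_def token_def split: if_splits)
  then show ?thesis using pl(1) assms(3) c by (auto simp: config_def dest: inj_onD)
qed

text \<open>Used twice: with \<open>k\<close> a precondition it controls the firing of
  \<open>Pn\<close>, with \<open>k\<close> a final marking it controls acceptance.\<close>

lemma bottom_covered:
  assumes c: "config s v x fs m" and z: "z \<in> verts s" and k: "k \<in> vecs (pn_places M)"
    and le: "(\<lambda>p. k p + token [Nt Z] p) \<le> marking s z"
  shows "z = v \<and> x = [Nt Z] \<and> fs = [] \<and> v = 0 \<and> k \<le> m"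
proof -
  have "token [Nt Z] \<le> marking s z" using le by (auto simp: le_fun_def intro: add_leD2)
  with token_le_marking[OF c z bottom_form] have zx: "z = v" "x = [Nt Z]" by auto
  with c have fs: "fs = []" by (cases fs) (auto simp: config_def)
  with c have v: "v = 0" by (simp add: config_def)
  have "k p \<le> m p" for p
    using le c zx fs v by (auto simp: config_def le_fun_def)
  with zx fs v show ?thesis by (auto simp: le_fun_def)
qed

section \<open>Soundness of the simulation\<close>

lemma net_simps [simp]:
  "Read a y \<in> Tel net \<longleftrightarrow> Tm a # y \<in> forms" "Pn t \<in> Tel net \<longleftrightarrow> t \<in> pn_trans M"
  "Call A y w \<in> Tab net \<longleftrightarrow> Nt A # y \<in> forms \<and> (A, w) \<in> prods G" "Tcut net = {Return}"
  "Wminus net (Read a y) = token (Tm a # y)" "Wminus net (Call A y w) = token (Nt A # y)"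
  "Wminus net Return = token []" "Wminus net (Pn t) = (\<lambda>p. pn_pre M t p + token [Nt Z] p)"
  "Wplus net (Read a y) = token y" "Wplus net (Call A y w) = token y"
  "Wplus net (Pn t) = (\<lambda>p. pn_post M t p + token [Nt Z] p)"
  "Omega net (Call A y w) = token w"
  "Call A y w \<notin> Tel net" "Return \<notin> Tel net" "Read a y \<notin> Tab net" "Pn t \<notin> Tab net" "Return \<notin> Tab net"
  by (auto simp: net_def)

lemma lab_simps [simp]:
  "lab (Read a y) = Some a" "lab (Call A y w) = None" "lab Return = None" "lab (Pn t) = lam t"
  by (simp_all add: lab_def)

lemma fire_config:
  assumes f: "fire net H s v' t s'" and c: "config s v x fs m"
  obtains (read) a y where "t = Read a y" "x = Tm a # y" "config s' v y fs m"
  | (call) A y w z where "t = Call A y w" "x = Nt A # y" "(A, w) \<in> prods G"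
      "config s' z w ((v, y) # fs) m"
  | (return) z y gs where "t = Return" "x = []" "fs = (z, y) # gs" "config s' z y gs m"
  | (pn) t' where "t = Pn t'" "x = [Nt Z]" "fs = []" "t' \<in> pn_trans M" "pn_pre M t' \<le> m"
      "config s' v [Nt Z] [] (\<lambda>p. m p - pn_pre M t' p + pn_post M t' p)"
  using f
proof cases
  case elementary
  show thesis
  proof (cases t)
    case (Read a y)
    with elementary token_le_marking[OF c, of v' "Tm a # y"] have "v' = v" "x = Tm a # y" by auto
    with read[OF Read] elementary Read config_read[of s v a y fs m] c show thesis by simp
  next
    case (Pn t')
    with elementary have t': "t' \<in> pn_trans M" by simp
    then have "pn_pre M t' \<in> vecs (pn_places M)" using M by (simp add: is_petri_net_def)
    from bottom_covered[OF c elementary(2) this] elementary Pn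
    have "v' = v" "x = [Nt Z]" "fs = []" "pn_pre M t' \<le> m" by auto
    with pn[OF Pn] t' elementary Pn config_pn[of s v m t'] c show thesis by simp
  qed (use elementary in auto)
next
  case (abstract w)
  then obtain A y u where t: "t = Call A y u" by (cases t) auto
  with abstract token_le_marking[OF c, of v' "Nt A # y"] have v: "v' = v" "x = Nt A # y" by auto
  with call[OF t v(2)] abstract t config_call[of s v A y fs m u w] c show thesis by simp
next
  case cut_root
  with token_le_marking[OF c, of v' "[]"] forms(2) have v: "v' = v" "x = []" by auto
  \<comment> \<open>An empty active form forces a pending caller, hence an edge into
    \<open>v\<close>; the root is never cut.\<close>
  with c cut_root(5) show thesis by (cases fs) (auto simp: config_def)
next
  case (cut_inner u)
  with token_le_marking[OF c, of v' "[]"] forms(2) have v: "v' = v" "x = []" by auto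
  with c obtain z y gs where fs: "fs = (z, y) # gs" by (cases fs) (auto simp: config_def)
  have "u = z" using cut_inner(5) c fs v by (auto simp: config_def dest: links_target)
  with return[OF _ v(2) fs] cut_inner config_return[of s v z y gs m] c fs v show thesis by simp
qed

text \<open>The concatenation of all pending forms is the sentential form still to be derived.
  \<open>Read\<close> strips a letter, \<open>Call\<close> expands the first nonterminal,
  \<open>Return\<close> changes nothing, and \<open>Pn\<close> requires that only the marker is
  left.\<close>

lemma run_config_sound:
  assumes "run net H s \<sigma> s'" "config s v x fs m" "sf \<in> finals" "sf \<preceq> s'"
  shows "\<exists>X u1 u2. concat (x # map snd fs) = X @ [Nt Z] \<and> leftmost G X u1 \<and>
    u2 \<in> pn_cov_lang M lam m F \<and> label_word lab (map snd \<sigma>) = u1 @ u2"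
  using assms
proof (induction arbitrary: v x fs m rule: run.induct)
  case (Nil H s)
  from Nil.prems(2) obtain k where k: "k \<in> F" "sf = single (\<lambda>p. token [Nt Z] p + k p)"
    by (auto simp: finals_def)
  \<comment> \<open>The embedding may send the vertex of \<open>sf\<close> to any thread; the marker
    forces it to be the root.\<close>
  with Nil.prems(3) obtain f where f: "f 0 \<in> verts s" "(\<lambda>p. k p + token [Nt Z] p) \<le> marking s (f 0)"
    by (auto simp: state_le_def single_def add.commute)
  from k F have "k \<in> vecs (pn_places M)" by blast
  from bottom_covered[OF Nil.prems(1) f(1) this f(2)] have x: "x = [Nt Z]" "fs = []" "k \<le> m" by auto
  have "[] \<in> pn_cov_lang M lam m F"
    using x(3) k(1) by (auto simp: pn_cov_lang_def intro!: exI[of _ "[]"] pn_run.Nil)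
  with x leftmost.Nil show ?case by force
next
  case (Cons H s v' t s' \<sigma> s'')
  from Cons.hyps(1) Cons.prems(1) show ?case
  proof (cases rule: fire_config)
    case (read a y)
    from Cons.IH[OF read(3) Cons.prems(2,3)] obtain X u1 u2 where
      "concat (y # map snd fs) = X @ [Nt Z]" "leftmost G X u1"
      "u2 \<in> pn_cov_lang M lam m F" "label_word lab (map snd \<sigma>) = u1 @ u2" by blast
    with read have "concat (x # map snd fs) = (Tm a # X) @ [Nt Z]" "leftmost G (Tm a # X) (a # u1)"
      "u2 \<in> pn_cov_lang M lam m F" "label_word lab (map snd ((v', t) # \<sigma>)) = (a # u1) @ u2"
      by (auto intro: leftmost.Tm)
    then show ?thesis by blast
  next
    case (call A y w z)
    from Cons.IH[OF call(4) Cons.prems(2,3)] obtain X u1 u2 where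
      X: "concat (w # map snd ((v, y) # fs)) = X @ [Nt Z]" "leftmost G X u1"
      "u2 \<in> pn_cov_lang M lam m F" "label_word lab (map snd \<sigma>) = u1 @ u2" by blast
    from call(4) have "ends_at_bottom Z y (map snd fs)" by (simp add: config_def)
    from ends_at_bottom_concat[OF this] obtain Y where Y: "concat (y # map snd fs) = Y @ [Nt Z]" by blast
    with X(1) have "X = w @ Y" by simp
    with X(2) call(3) have "leftmost G (Nt A # Y) u1" by (auto intro: leftmost.Nt)
    moreover have "concat (x # map snd fs) = (Nt A # Y) @ [Nt Z]"
      "label_word lab (map snd ((v', t) # \<sigma>)) = u1 @ u2"
      using X(4) Y call by auto
    ultimately show ?thesis using X(3) by blast
  next
    case (return z y gs)
    from Cons.IH[OF return(4) Cons.prems(2,3)] return show ?thesis by simp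
  next
    case (pn t')
    from Cons.IH[OF pn(6) Cons.prems(2,3)] obtain X u1 u2 where
      X: "concat ([Nt Z] # map snd ([] :: (thread \<times> 'a form) list)) = X @ [Nt Z]" "leftmost G X u1"
      "u2 \<in> pn_cov_lang M lam (\<lambda>p. m p - pn_pre M t' p + pn_post M t' p) F"
      "label_word lab (map snd \<sigma>) = u1 @ u2" by blast
    \<comment> \<open>Once the Petri net has started, the derivation has nothing left to
      contribute.\<close>
    from X(1,2) have [simp]: "X = []" "u1 = []" by (auto elim: leftmost_NilE)
    have "label_word lab (map snd ((v', t) # \<sigma>)) \<in> pn_cov_lang M lam m F"
      using pn_cov_lang_step[OF pn(4,5) X(3)] X(4) pn(1) by simp
    moreover have "concat (x # map snd fs) = [] @ [Nt Z]" using pn by simp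
    ultimately show ?thesis using leftmost.Nil append_Nil by metis
  qed
qed

section \<open>Completeness of the simulation\<close>

definition accepts :: "thread set \<Rightarrow> nat state \<Rightarrow> 'a list \<Rightarrow> bool" where
  "accepts H s u \<longleftrightarrow> (\<exists>\<sigma> s'. run net H s \<sigma> s' \<and> (\<exists>sf\<in>finals. sf \<preceq> s') \<and> u = label_word lab (map snd \<sigma>))"

lemma accepts_fire:
  assumes "fire net H s v t s'" "accepts (H \<union> verts s) s' u"
  shows "accepts H s ((case lab t of None \<Rightarrow> [] | Some a \<Rightarrow> [a]) @ u)"
proof -
  from assms(2) obtain \<sigma> s'' where *: "run net (H \<union> verts s) s' \<sigma> s''" "\<exists>sf\<in>finals. sf \<preceq> s''"
    "u = label_word lab (map snd \<sigma>)" unfolding accepts_def by blast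
  from run.Cons[OF assms(1) *(1)] *(2,3) show ?thesis
    unfolding accepts_def by (intro exI[of _ "(v, t) # \<sigma>"] exI[of _ s'']) auto
qed

lemma accepts_pn:
  assumes "pn_run M m \<tau> m'" "k \<in> F" "k \<le> m'" "config s v [Nt Z] [] m"
  shows "accepts H s (label_word lam \<tau>)"
  using assms
proof (induction arbitrary: H s rule: pn_run.induct)
  case (Nil m)
  have "single (\<lambda>p. token [Nt Z] p + k p) \<preceq> s"
    using Nil.prems(2,3) by (auto simp: state_le_def single_def config_def le_fun_def intro!: exI[of _ id])
  with Nil.prems(1) show ?case unfolding accepts_def finals_def
    by (intro exI[of _ "[]"] exI[of _ s]) (auto intro: run.Nil)
next
  case (Cons t m \<tau> m')
  let ?s = "s\<lparr>marking := (marking s)(v := \<lambda>p. marking s v p - (pn_pre M t p + token [Nt Z] p)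
      + (pn_post M t p + token [Nt Z] p))\<rparr>"
  have "Wminus net (Pn t) \<le> marking s v"
    using Cons.hyps(2) Cons.prems(3) by (auto simp: config_def le_fun_def)
  with fire.elementary[of v s "Pn t" net H] Cons have "fire net H s v (Pn t) ?s"
    by (simp add: config_def)
  from accepts_fire[OF this Cons.IH[OF Cons.prems(1,2) config_pn[OF Cons.prems(3) Cons.hyps(1,2)]]]
  show ?case by simp
qed

lemma fire_return:
  assumes "config s v [] ((z, y) # fs) m"
  shows "\<exists>s'. fire net H s v Return s' \<and> config s' z y fs m"
proof -
  have "Wminus net Return \<le> marking s v" "(z, v) \<in> edges s" "v \<in> verts s"
    using assms by (auto simp: config_def le_fun_def)
  with fire.cut_inner[of v s Return net z H] config_return[OF assms] show ?thesis by auto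
qed

text \<open>Reduces the construction of runs to nonempty active forms: returning from empty ones
  shortens the stack and preserves the concatenation. \<open>x0\<close> and \<open>fs0\<close> fix
  that concatenation during the induction; at the root the form is nonempty because of the
  marker.\<close>

lemma accepts_after_returns:
  assumes "config s v x fs m" "finite H"
    and "\<And>H s v x fs'. \<lbrakk>config s v x fs' m; finite H; x \<noteq> [];
      concat (x # map snd fs') = concat (x0 # map snd fs0)\<rbrakk> \<Longrightarrow> accepts H s u"
    and "concat (x # map snd fs) = concat (x0 # map snd fs0)"
  shows "accepts H s u"
  using assms
proof (induction fs arbitrary: H s v x)
  case Nil
  from Nil.prems(1) have "x \<noteq> []" by (auto simp: config_def)
  with Nil show ?case by blast
next
  case (Cons f fs)
  obtain z y where f: "f = (z, y)" by force
  show ?case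
  proof (cases "x = []")
    case True
    with Cons.prems(1) f fire_return obtain s' where
      s': "fire net H s v Return s'" "config s' z y fs m" by blast
    have "accepts (H \<union> verts s) s' u"
      using Cons.IH[OF s'(2) _ Cons.prems(3)] Cons.prems(2,4) config_finite[OF Cons.prems(1)] True f by simp
    from accepts_fire[OF s'(1) this] show ?thesis by simp
  next
    case False
    with Cons.prems show ?thesis by blast
  qed
qed

text \<open>Each rule of the leftmost derivation is played by one move, after the returns that bring
  the next symbol into the active thread. Finiteness of \<open>H\<close> guarantees a fresh thread
  for every call.\<close>

lemma accepts_config:
  assumes "leftmost G X u1" "u2 \<in> pn_cov_lang M lam m F"
    and "config s v x fs m" "finite H" "concat (x # map snd fs) = X @ [Nt Z]"
  shows "accepts H s (u1 @ u2)"
  using assms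
proof (induction arbitrary: H s v x fs rule: leftmost.induct)
  case Nil
  show ?case
  proof (rule accepts_after_returns[OF Nil.prems(2,3) _ refl])
    fix H :: "thread set" and s v x' fs'
    assume c: "config s v x' fs' m" and "x' \<noteq> []" "concat (x' # map snd fs') = concat (x # map snd fs)"
    with Nil.prems(4) have x': "x' = [Nt Z]" by (cases x') auto
    with c have "fs' = []" by (cases fs') (auto simp: config_def)
    with c x' accepts_pn Nil.prems(1) show "accepts H s ([] @ u2)" by (auto simp: pn_cov_lang_def)
  qed
next
  case (Tm X u1 a)
  show ?case
  proof (rule accepts_after_returns[OF Tm.prems(2,3) _ refl])
    fix H :: "thread set" and s v x' fs'
    assume c: "config s v x' fs' m" and H: "finite H" and x': "x' \<noteq> []"
      "concat (x' # map snd fs') = concat (x # map snd fs)"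
    with Tm.prems(4) obtain y where y: "x' = Tm a # y" "concat (y # map snd fs') = X @ [Nt Z]"
      by (cases x') auto
    have "fire net H s v (Read a y)
        (s\<lparr>marking := (marking s)(v := \<lambda>p. marking s v p - token (Tm a # y) p + token y p)\<rparr>)"
      using fire.elementary[of v s "Read a y" net H] c y(1) by (auto simp: config_def le_fun_def)
    from accepts_fire[OF this Tm.IH[OF Tm.prems(1) config_read _ y(2)]] c y(1) H config_finite[OF c]
    show "accepts H s ((a # u1) @ u2)" by simp
  qed
next
  case (Nt A w X u1)
  show ?case
  proof (rule accepts_after_returns[OF Nt.prems(2,3) _ refl])
    fix H :: "thread set" and s v x' fs'
    assume c: "config s v x' fs' m" and H: "finite H" and x': "x' \<noteq> []"
      "concat (x' # map snd fs') = concat (x # map snd fs)"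
    with Nt.prems(4) obtain y where y: "x' = Nt A # y" "concat (y # map snd fs') = X @ [Nt Z]"
      by (cases x') auto
    obtain z where z: "z \<notin> H \<union> verts s"
      using ex_new_if_finite[OF infinite_UNIV_nat, of "H \<union> verts s"] H config_finite[OF c] by blast
    have "fire net H s v (Call A y w) \<lparr>verts = insert z (verts s), edges = insert (v, z) (edges s),
      marking = (marking s)(v := \<lambda>p. marking s v p - token (Nt A # y) p, z := token w),
      elabel = (elabel s)((v, z) := token y)\<rparr>"
      using fire.abstract[of v s "Call A y w" net z H] c y(1) Nt.hyps(1) z
      by (auto simp: config_def le_fun_def)
    from accepts_fire[OF this Nt.IH[OF Nt.prems(1) config_call]] c y Nt.hyps(1) z H config_finite[OF c]
    show "accepts H s (u1 @ u2)" by auto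
  qed
qed

lemma config_init: "config init 0 [Nt (start G), Nt Z] [] m0"
  using forms m0 by (simp add: config_def init_def single_def)

lemma rpn_cov_lang_net:
  "rpn_cov_lang net lab init finals = {u @ v | u v. u \<in> cfg_lang G \<and> v \<in> pn_cov_lang M lam m0 F}"
    (is "?L = ?R")
proof (intro equalityI subsetI)
  fix w assume "w \<in> ?L"
  then obtain \<sigma> s sf where "w = label_word lab (map snd \<sigma>)" "run net {} init \<sigma> s" "sf \<in> finals" "sf \<preceq> s"
    by (auto simp: rpn_cov_lang_def)
  with run_config_sound[OF _ config_init] show "w \<in> ?R" by (fastforce simp: cfg_lang_leftmost)
next
  fix w assume "w \<in> ?R"
  then obtain u v where "w = u @ v" "leftmost G [Nt (start G)] u" "v \<in> pn_cov_lang M lam m0 F"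
    by (auto simp: cfg_lang_leftmost)
  with accepts_config[OF _ _ config_init, of "[Nt (start G)]" u v "{}"] have "accepts {} init w" by simp
  then show "w \<in> ?L" by (auto simp: accepts_def rpn_cov_lang_def)
qed

section \<open>Well-formedness of the simulating net\<close>

lemma token_vecs: "x \<in> forms \<Longrightarrow> token x \<in> vecs (places net)"
  by (auto simp: token_def vecs_def net_def)

lemma vecs_add:
  assumes "m \<in> vecs (pn_places M)" "x \<in> forms"
  shows "(\<lambda>p. m p + token x p) \<in> vecs (places net)" "(\<lambda>p. token x p + m p) \<in> vecs (places net)"
  using assms token_vecs[OF assms(2)] by (auto simp: vecs_def net_def)

lemma is_rpn_net: "is_rpn net"
proof -
  have "finite ((\<lambda>x. Read (case hd x of Tm a \<Rightarrow> a) (tl x)) ` forms)" using forms(1) by simp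
  moreover have "{Read a y | a y. Tm a # y \<in> forms} \<subseteq> (\<lambda>x. Read (case hd x of Tm a \<Rightarrow> a) (tl x)) ` forms"
    by force
  ultimately have "finite {Read a y | a y. Tm a # y \<in> forms}" by (rule rev_finite_subset)
  moreover have "finite (Pn ` pn_trans M)" using M by (simp add: is_petri_net_def)
  ultimately have 1: "finite (Tel net)" by (simp add: net_def)
  have "finite ((\<lambda>(x, A, w). Call A (tl x) w) ` (forms \<times> prods G))"
    using forms(1) G by (simp add: is_cfg_def)
  moreover have "Tab net \<subseteq> (\<lambda>(x, A, w). Call A (tl x) w) ` (forms \<times> prods G)"
    by (force simp: net_def)
  ultimately have "finite (Tab net)" by (rule rev_finite_subset)
  with 1 have fin: "finite (transitions net)" by (simp add: transitions_def)
  have "finite (places net)" using forms(1) M by (simp add: net_def is_petri_net_def)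
  moreover have "Wminus net t \<in> vecs (places net)" if "t \<in> transitions net" for t
    using that M bottom_form forms(2)
    by (cases t) (auto simp: transitions_def is_petri_net_def intro!: vecs_add token_vecs)
  moreover have "Wplus net t \<in> vecs (places net)" if "t \<in> Tel net \<union> Tab net" for t
    using that M bottom_form forms_tail
    by (cases t) (auto simp: is_petri_net_def intro!: vecs_add token_vecs)
  moreover have "Omega net t \<in> vecs (places net)" if "t \<in> Tab net" for t
    using that forms(4) by (cases t) (force intro!: token_vecs)+
  ultimately show ?thesis using fin unfolding is_rpn_def by (auto simp: net_def)
qed

lemma is_state_single: "m \<in> vecs (places net) \<Longrightarrow> is_state net (single m)"
  by (auto simp: is_state_def single_def rooted_tree_def)

lemma concat_in_rpn_cov_langs:
  "{u @ v | u v. u \<in> cfg_lang G \<and> v \<in> pn_cov_lang M lam m0 F} \<in> rpn_cov_langs"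
proof -
  have "is_state net init" unfolding init_def
    using m0 forms(3) by (intro is_state_single vecs_add)
  moreover have "\<forall>sf\<in>finals. is_state net sf" unfolding finals_def
    using F(2) bottom_form by (auto intro!: is_state_single vecs_add)
  moreover have "finite finals" using F(1) by (simp add: finals_def)
  ultimately show ?thesis
    using rpn_cov_langsI[OF is_rpn_net, of init finals lab] rpn_cov_lang_net by simp
qed

end

lemma suffixes_finite:
  assumes "finite (B :: 'b list set)"
  shows "finite {y. \<exists>x. x @ y \<in> B}"
proof -
  have "{y. \<exists>x. x @ y \<in> B} \<subseteq> (\<Union>z\<in>B. (\<lambda>n. drop n z) ` {..length z})"
  proof
    fix y assume "y \<in> {y. \<exists>x. x @ y \<in> B}"
    then obtain x where "x @ y \<in> B" by blast
    moreover have "y = drop (length x) (x @ y)" by simp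
    moreover have "length x \<in> {..length (x @ y)}" by simp
    ultimately show "y \<in> (\<Union>z\<in>B. (\<lambda>n. drop n z) ` {..length z})" by blast
  qed
  then show ?thesis by (rule finite_subset) (use assms in simp)
qed

lemma concat_rpn_cov_langs:
  assumes "L1 \<in> cf_langs" "L2 \<in> pn_cov_langs"
  shows "{u @ v | u v. u \<in> L1 \<and> v \<in> L2} \<in> rpn_cov_langs"
proof -
  from assms(1) obtain G :: "(nat, 'a) cfg" where G: "is_cfg G" and L1: "L1 = cfg_lang G"
    by (auto simp: cf_langs_def)
  from assms(2) obtain M :: "(nat, nat) petri_net" and lam m0 F where
    M: "is_petri_net M" "m0 \<in> vecs (pn_places M)" "finite F" "F \<subseteq> vecs (pn_places M)"
      and L2: "L2 = pn_cov_lang M lam m0 F"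
    by (auto simp: pn_cov_langs_def)
  obtain Z where Z: "Z \<notin> nonterms G"
    using ex_new_if_finite[OF infinite_UNIV_nat] G by (auto simp: is_cfg_def)
  \<comment> \<open>The forms needed at the outset: \<open>[]\<close> for \<open>Return\<close>, the
    marked start form, and the right-hand sides. Closing under suffixes accounts for reading and
    calling.\<close>
  define B where "B = insert [] (insert [Nt (start G), Nt Z] (snd ` prods G))"
  define forms where "forms = {y. \<exists>x. x @ y \<in> B}"
  have fin: "finite forms" unfolding forms_def
    using G by (intro suffixes_finite) (simp add: B_def is_cfg_def)
  have sub: "B \<subseteq> forms" unfolding forms_def by (auto intro: exI[of _ "[]"])
  have tail: "x \<in> forms" if "a # x \<in> forms" for a x
  proof -
    from that obtain p where "p @ a # x \<in> B" by (auto simp: forms_def)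
    then have "(p @ [a]) @ x \<in> B" by simp
    then show ?thesis unfolding forms_def by blast
  qed
  obtain f :: "'a form \<Rightarrow> nat" where f: "inj_on f forms"
    using finite_imp_inj_to_nat_seg[OF fin] by blast
  \<comment> \<open>The shift puts the places of forms above all places of the Petri net.\<close>
  define pl where "pl x = f x + Suc (Max (insert 0 (pn_places M)))" for x
  have "pl x \<notin> pn_places M" for x
  proof
    assume "pl x \<in> pn_places M"
    then have "pl x \<le> Max (insert 0 (pn_places M))"
      using M(1) by (intro Max_ge) (auto simp: is_petri_net_def)
    then show False by (simp add: pl_def)
  qed
  then have "pl ` forms \<inter> pn_places M = {}" by auto
  moreover have "inj_on pl forms" using f by (simp add: inj_on_def pl_def)
  ultimately interpret cfg_then_pn G M lam m0 F Z forms pl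
    using G M Z fin sub tail by unfold_locales (auto simp: B_def)
  show ?thesis using concat_in_rpn_cov_langs L1 L2 by simp
qed

section \<open>The separating language\<close>

lemma singleton_Nil_cf: "{[]} \<in> cf_langs"
proof -
  define G :: "(nat, 'a) cfg" where "G = \<lparr>nonterms = {0}, terms = {}, prods = {(0, [])}, start = 0\<rparr>"
  have "leftmost G [Nt 0] u \<longleftrightarrow> u = []" for u
    by (auto simp: G_def intro!: leftmost.intros elim!: leftmost_NtE leftmost_NilE)
  then have "cfg_lang G = {[]}" by (auto simp: cfg_lang_leftmost G_def)
  moreover have "is_cfg G" by (simp add: is_cfg_def G_def)
  ultimately show ?thesis unfolding cf_langs_def by blast
qed

lemma pn_cov_langsI:
  fixes N :: "(nat, nat) petri_net"
  assumes "is_petri_net N" "is_labelling (pn_trans N) \<Sigma> lam" "m0 \<in> vecs (pn_places N)"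
    and "finite F" "F \<subseteq> vecs (pn_places N)"
  shows "pn_cov_lang N lam m0 F \<in> pn_cov_langs"
  unfolding pn_cov_langs_def using assms by blast

lemma singleton_Nil_pn: "{[]} \<in> pn_cov_langs"
proof -
  define N :: "(nat, nat) petri_net" where
    "N = \<lparr>pn_places = {}, pn_trans = {}, pn_pre = (\<lambda>_ _. 0), pn_post = (\<lambda>_ _. 0)\<rparr>"
  define lam :: "nat \<Rightarrow> 'a option" where "lam = (\<lambda>_. None)"
  have "pn_run N m \<sigma> m' \<Longrightarrow> \<sigma> = []" for m \<sigma> m'
    by (erule pn_run.cases) (auto simp: N_def)
  then have "pn_run N m \<sigma> m' \<longleftrightarrow> \<sigma> = [] \<and> m' = m" for m \<sigma> m'
    by (auto intro: pn_run.Nil elim: pn_run_NilE)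
  then have "pn_cov_lang N lam (\<lambda>_. 0) {\<lambda>_. 0} = {[]}"
    by (auto simp: pn_cov_lang_def )
  moreover have "is_petri_net N" "is_labelling (pn_trans N) {} lam" "(\<lambda>_. 0) \<in> vecs (pn_places N)"
    by (auto simp: is_petri_net_def is_labelling_def N_def vecs_def)
  ultimately show ?thesis using pn_cov_langsI[of N "{}" lam "\<lambda>_. 0" "{\<lambda>_. 0}"] by simp
qed

definition balanced :: "'a \<Rightarrow> 'a \<Rightarrow> 'a list set" where
  "balanced a b = {replicate n a @ replicate n b | n. True}"

definition descending :: "'a \<Rightarrow> 'a \<Rightarrow> 'a \<Rightarrow> 'a list set" where
  "descending c d e = {replicate i c @ replicate k d @ replicate j e | i k j. j \<le> k \<and> k \<le> i}"

lemma balanced_cf: "balanced a b \<in> cf_langs"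
proof -
  define G :: "(nat, 'a) cfg" where
    "G = \<lparr>nonterms = {0}, terms = {a, b}, prods = {(0, []), (0, [Tm a, Nt 0, Tm b])}, start = 0\<rparr>"
  \<comment> \<open>Peeling off the outermost \<open>a\<close> and \<open>b\<close> leaves a parse
    with fewer productions.\<close>
  have sound: "\<exists>n. u = replicate n a @ replicate n b" if "parses G k [Nt 0] u" for k u
    using that
  proof (induction k arbitrary: u rule: less_induct)
    case (less k)
    from less.prems obtain w j where w: "(0, w) \<in> prods G" "parses G j w u" "k = Suc j"
      by (auto elim!: parses_NtE parses_NilE)
    show ?case
    proof (cases "w = []")
      case True
      with w have "u = []" by (auto elim: parses_NilE)
      then show ?thesis by (auto intro: exI[of _ 0])
    next
      case False
      with w have "parses G j [Tm a, Nt 0, Tm b] u" by (auto simp: G_def)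
      then obtain u' w' i l where u': "u = a # u' @ [b]" "(0, w') \<in> prods G" "parses G i w' u'" "j = Suc i"
        by (auto elim!: parses_TmE parses_NtE parses_NilE)
      from parses.Nt[OF u'(2,3) parses.Nil] have "parses G j [Nt 0] u'" using u'(4) by simp
      from less.IH[OF _ this] w(3) obtain n where "u' = replicate n a @ replicate n b" by auto
      with u'(1) have "u = replicate (Suc n) a @ replicate (Suc n) b" by (simp add: replicate_append_same)
      then show ?thesis by blast
    qed
  qed
  have complete: "\<exists>k. parses G k [Nt 0] (replicate n a @ replicate n b)" for n
  proof (induction n)
    case 0
    have "parses G (Suc (0 + 0)) [Nt 0] ([] @ [])"
      by (rule parses.Nt[of _ "[]"]) (auto simp: G_def intro: parses.Nil)
    then show ?case by auto
  next
    case (Suc n)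
    then obtain k where "parses G k [Nt 0] (replicate n a @ replicate n b)" by blast
    moreover have "parses G 0 [Tm b] [b]" by (intro parses.intros)
    ultimately have "parses G (k + 0) ([Nt 0] @ [Tm b]) ((replicate n a @ replicate n b) @ [b])"
      by (rule parses_sized_append)
    then have "parses G k [Tm a, Nt 0, Tm b] (a # replicate n a @ replicate n b @ [b])"
      by (auto intro: parses.Tm)
    from parses.Nt[OF _ this parses.Nil, of 0]
    have "parses G (Suc k) [Nt 0] (a # replicate n a @ replicate n b @ [b])" by (simp add: G_def)
    then show ?case by (auto simp: replicate_append_same)
  qed
  have "cfg_lang G = balanced a b"
    using sound complete by (auto simp: cfg_lang_parses balanced_def G_def)
  moreover have "is_cfg G" by (auto simp: is_cfg_def G_def)
  ultimately show ?thesis unfolding cf_langs_def by blast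
qed

text \<open>Places \<open>0\<close>, \<open>1\<close>, \<open>2\<close> mark the phases writing \<open>c\<close>, \<open>d\<close>, \<open>e\<close>; places \<open>3\<close> and \<open>4\<close> hold the
  surplus of \<open>c\<close> over \<open>d\<close> and of \<open>d\<close> over \<open>e\<close>. Transitions \<open>3\<close> and \<open>4\<close> change the phase.\<close>

definition phases :: "(nat, nat) petri_net" where
  "phases = \<lparr>pn_places = {..<5}, pn_trans = {..<5},
     pn_pre = (\<lambda>t. count_list ([[0], [1, 3], [2, 4], [0], [1]] ! t)),
     pn_post = (\<lambda>t. count_list ([[0, 3], [1, 4], [2], [1], [2]] ! t))\<rparr>"

definition phase_label :: "'a \<Rightarrow> 'a \<Rightarrow> 'a \<Rightarrow> nat \<Rightarrow> 'a option" where
  "phase_label c d e t = [Some c, Some d, Some e, None, None] ! t"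

lemma phases_trans: "pn_trans phases = {0, 1, 2, 3, 4}"
  by (auto simp: phases_def)

lemma phases_simps [simp]:
  "pn_places phases = {..<5}"
  "pn_pre phases 0 = count_list [0]" "pn_post phases 0 = count_list [0, 3]"
  "pn_pre phases (Suc 0) = count_list [1, 3]" "pn_post phases (Suc 0) = count_list [1, 4]"
  "pn_pre phases 2 = count_list [2, 4]" "pn_post phases 2 = count_list [2]"
  "pn_pre phases 3 = count_list [0]" "pn_post phases 3 = count_list [1]"
  "pn_pre phases 4 = count_list [1]" "pn_post phases 4 = count_list [2]"
  by (simp_all add: phases_def)

lemma phase_label_simps [simp]:
  "phase_label c d e 0 = Some c" "phase_label c d e (Suc 0) = Some d" "phase_label c d e 2 = Some e"
  "phase_label c d e 3 = None" "phase_label c d e 4 = None"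
  by (simp_all add: phase_label_def)

lemma count_list_le_iff:
  "count_list [p] \<le> m \<longleftrightarrow> 1 \<le> m p"
  "p \<noteq> q \<Longrightarrow> count_list [p, q] \<le> m \<longleftrightarrow> 1 \<le> m p \<and> 1 \<le> m q"
  by (auto simp: le_fun_def)

text \<open>Generalised to any marking with a single phase token: the stored surpluses enter the
  bounds, and the two implications say which letters can no longer be written. The word is read off
  from the first transition of the run.\<close>

lemma phases_sound:
  assumes "pn_run phases m \<sigma> m'" "m 0 + m 1 + m 2 = 1"
  shows "\<exists>i k j. label_word (phase_label c d e) \<sigma> = replicate i c @ replicate k d @ replicate j e \<and>
    (m 0 = 0 \<longrightarrow> i = 0) \<and> (m 2 \<noteq> 0 \<longrightarrow> k = 0) \<and> k \<le> m 3 + i \<and> j \<le> m 4 + k"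
  using assms
proof (induction rule: pn_run.induct)
  case (Nil m)
  show ?case by simp
next
  case (Cons t m \<sigma> m')
  let ?Q = "\<lambda>i k j. label_word (phase_label c d e) (t # \<sigma>) = replicate i c @ replicate k d @ replicate j e \<and>
    (m 0 = 0 \<longrightarrow> i = 0) \<and> (m 2 \<noteq> 0 \<longrightarrow> k = 0) \<and> k \<le> m 3 + i \<and> j \<le> m 4 + k"
  from Cons.hyps(1) consider "t = 0" | "t = 1" | "t = 2" | "t = 3" | "t = 4"
    by (auto simp: phases_trans)
  then have "\<exists>i k j. ?Q i k j"
  proof cases
    case 1
    with Cons have m: "m 0 = 1" "m 1 = 0" "m 2 = 0" by (auto simp: count_list_le_iff)
    with Cons.IH 1 obtain i k j where
      "label_word (phase_label c d e) \<sigma> = replicate i c @ replicate k d @ replicate j e"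
      "k \<le> m 3 + 1 + i" "j \<le> m 4 + k" by auto
    with 1 m have "?Q (Suc i) k j" by simp
    then show ?thesis by (intro exI)
  next
    case 2
    with Cons have m: "m 0 = 0" "m 1 = 1" "m 2 = 0" "m 3 \<ge> 1" by (auto simp: count_list_le_iff)
    with Cons.IH 2 obtain k j where
      "label_word (phase_label c d e) \<sigma> = replicate k d @ replicate j e"
      "k \<le> m 3 - 1" "j \<le> m 4 + 1 + k" by auto
    with 2 m have "?Q 0 (Suc k) j" by auto
    then show ?thesis by (intro exI)
  next
    case 3
    with Cons have m: "m 0 = 0" "m 1 = 0" "m 2 = 1" "m 4 \<ge> 1" by (auto simp: count_list_le_iff)
    with Cons.IH 3 obtain j where
      "label_word (phase_label c d e) \<sigma> = replicate j e" "j \<le> m 4 - 1" by auto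
    with 3 m have "?Q 0 0 (Suc j)" by auto
    then show ?thesis by (intro exI)
  next
    case 4
    with Cons have m: "m 0 = 1" "m 1 = 0" "m 2 = 0" by (auto simp: count_list_le_iff)
    with Cons.IH 4 obtain k j where
      "label_word (phase_label c d e) \<sigma> = replicate k d @ replicate j e" "k \<le> m 3" "j \<le> m 4 + k"
      by auto
    with 4 m have "?Q 0 k j" by simp
    then show ?thesis by (intro exI)
  next
    case 5
    with Cons have m: "m 0 = 0" "m 1 = 1" "m 2 = 0" by (auto simp: count_list_le_iff)
    with Cons.IH 5 obtain j where
      "label_word (phase_label c d e) \<sigma> = replicate j e" "j \<le> m 4" by auto
    with 5 m have "?Q 0 0 j" by simp
    then show ?thesis by (intro exI)
  qed
  then show ?case .
qed

text \<open>Built from the last phase backwards, each phase change being the base case of the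
  induction for the phase before it. Every marking covers the zero marking, so leftover surpluses do
  no harm.\<close>

lemma phases_complete:
  fixes c d e defines "L \<equiv> \<lambda>m. pn_cov_lang phases (phase_label c d e) m {\<lambda>_. 0}"
  assumes "m 0 \<ge> 1" "k \<le> m 3 + i" "j \<le> m 4 + k"
  shows "replicate i c @ replicate k d @ replicate j e \<in> L m"
proof -
  have step: "(case phase_label c d e t of None \<Rightarrow> [] | Some a \<Rightarrow> [a]) @ u \<in> L m"
    if "t \<in> {0, 1, 2, 3, 4}" "pn_pre phases t \<le> m"
      "u \<in> L (\<lambda>p. m p - pn_pre phases t p + pn_post phases t p)" for t m u
    using that pn_cov_lang_step[of t phases m u "phase_label c d e" "{\<lambda>_. 0}"]
    by (simp only: phases_trans L_def)
  have 1: "replicate j e \<in> L m" if "m 2 \<ge> 1" "j \<le> m 4" for j m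
    using that
  proof (induction j arbitrary: m)
    case 0
    show ?case unfolding L_def pn_cov_lang_def
      by (auto simp: le_fun_def intro!: exI[of _ "[]"] exI[of _ m] pn_run.Nil)
  next
    case (Suc j)
    with step[of 2 m "replicate j e"] show ?case by (simp add: count_list_le_iff)
  qed
  have 2: "replicate k d @ replicate j e \<in> L m" if "m 1 \<ge> 1" "k \<le> m 3" "j \<le> m 4 + k" for k j m
    using that
  proof (induction k arbitrary: m)
    case 0
    with step[of 4 m "replicate j e"] 1 show ?case by (simp add: count_list_le_iff)
  next
    case (Suc k)
    with step[of 1 m "replicate k d @ replicate j e"] show ?case by (simp add: count_list_le_iff)
  qed
  from assms(2-4) show ?thesis
  proof (induction i arbitrary: m)
    case 0
    with step[of 3 m "replicate k d @ replicate j e"] 2 show ?case by (simp add: count_list_le_iff)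
  next
    case (Suc i)
    with step[of 0 m "replicate i c @ replicate k d @ replicate j e"] show ?case
      by (simp add: count_list_le_iff)
  qed
qed

lemma descending_pn: "descending c d e \<in> pn_cov_langs"
proof -
  let ?m = "(\<lambda>p. if p = 0 then 1 else 0) :: nat \<Rightarrow> nat"
  have "is_petri_net phases"
    unfolding is_petri_net_def phases_trans by (auto simp: vecs_def)
  moreover have "is_labelling (pn_trans phases) {c, d, e} (phase_label c d e)"
    by (simp add: is_labelling_def phases_trans)
  moreover have "?m \<in> vecs (pn_places phases)" "{\<lambda>_. 0} \<subseteq> vecs (pn_places phases)"
    by (auto simp: vecs_def)
  moreover have "pn_cov_lang phases (phase_label c d e) ?m {\<lambda>_. 0} = descending c d e"
  proof (intro equalityI subsetI)
    fix u assume "u \<in> pn_cov_lang phases (phase_label c d e) ?m {\<lambda>_. 0}"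
    then obtain \<sigma> m' where "u = label_word (phase_label c d e) \<sigma>" "pn_run phases ?m \<sigma> m'"
      by (auto simp: pn_cov_lang_def)
    with phases_sound[of ?m \<sigma> m' c d e] show "u \<in> descending c d e"
      by (auto simp: descending_def)
  next
    fix u assume "u \<in> descending c d e"
    then show "u \<in> pn_cov_lang phases (phase_label c d e) ?m {\<lambda>_. 0}"
      by (auto simp: descending_def intro!: phases_complete)
  qed
  ultimately show ?thesis
    using pn_cov_langsI[of phases "{c, d, e}" "phase_label c d e" ?m "{\<lambda>_. 0}"] by simp
qed

section \<open>Separation from both families\<close>

lemma count_list_replicate: "count_list (replicate n x) y = (if x = y then n else 0)"
  by (induction n) auto

definition separating :: "'a \<Rightarrow> 'a \<Rightarrow> 'a \<Rightarrow> 'a \<Rightarrow> 'a \<Rightarrow> 'a list set" where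
  "separating a b c d e = {u @ v | u v. u \<in> balanced a b \<and> v \<in> descending c d e}"

lemma separating_not_pn:
  assumes "distinct [a, b, c, d, e]"
  shows "separating a b c d e \<notin> pn_cov_langs"
proof
  let ?L = "separating a b c d e"
  assume L: "?L \<in> pn_cov_langs"
  have "[] \<in> descending c d e" by (auto simp: descending_def)
  then have "replicate n a @ replicate n b \<in> ?L" for n
    unfolding separating_def balanced_def by force
  from pn_cov_lang_exchange[OF L this] obtain i j where
    ij: "i < j" "replicate j a @ replicate i b \<in> ?L" by blast
  from ij(2) obtain u v where uv: "replicate j a @ replicate i b = u @ v" "u \<in> balanced a b"
    "v \<in> descending c d e" by (auto simp: separating_def)
  \<comment> \<open>The alphabets of the factors are disjoint, so the descending factor must be
    empty.\<close>
  have "set v \<subseteq> {c, d, e}" using uv(3) by (auto simp: descending_def)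
  moreover have "set v \<subseteq> set (replicate j a @ replicate i b)" unfolding uv(1) by simp
  then have "set v \<subseteq> {a, b}" by (auto split: if_splits)
  ultimately have "v = []" using assms by (cases v) auto
  with uv obtain n where n: "replicate j a @ replicate i b = replicate n a @ replicate n b"
    by (auto simp: balanced_def)
  have ab: "a \<noteq> b" using assms by simp
  from arg_cong[OF n, of "\<lambda>x. count_list x a"] arg_cong[OF n, of "\<lambda>x. count_list x b"] ab
  have "j = n" "i = n" by (simp_all add: count_list_append count_list_replicate)
  with ij(1) show False by simp
qed

text \<open>Order and counts are separated: sortedness by rank limits which letters a repeated
  factor may contain, and the counts are additive under pumping.\<close>

lemma descendingD:
  assumes "w \<in> descending c d e" "distinct [c, d, e]"
  shows "sorted (map (\<lambda>z. if z = c then 0 else if z = d then 1 else 2 :: nat) w)"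
    "count_list w e \<le> count_list w d" "count_list w d \<le> count_list w c"
  using assms by (auto simp: descending_def sorted_append count_list_append count_list_replicate split: if_splits)

lemma separating_cde:
  assumes "w \<in> separating a b c d e" "set w \<subseteq> {c, d, e}" "distinct [a, b, c, d, e]"
  shows "w \<in> descending c d e"
proof -
  from assms(1) obtain n v where w: "w = (replicate n a @ replicate n b) @ v" "v \<in> descending c d e"
    by (auto simp: separating_def balanced_def)
  with assms(2,3) have "n = 0" by (cases n) auto
  with w show ?thesis by simp
qed

text \<open>In \<open>v @ v\<close> any two letters of \<open>v\<close> occur in both orders, so
  their ranks are equal.\<close>

lemma sorted_square_constant:
  assumes "sorted (map r (p @ (v @ v) @ q))" "x \<in> set v" "y \<in> set v"
  shows "r x = r y"
  using assms by (auto simp: sorted_append intro!: antisym)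

lemma separating_not_cf:
  assumes dist: "distinct [a, b, c, d, e]"
  shows "separating a b c d e \<notin> cf_langs"
proof
  let ?L = "separating a b c d e"
  let ?w = "\<lambda>n. replicate n c @ replicate n d @ replicate n e"
  assume "?L \<in> cf_langs"
  from context_free_pumping[OF this] obtain B where B: "finite B"
    "\<And>u. u \<in> ?L \<Longrightarrow> u \<notin> B \<Longrightarrow>
      \<exists>p v w y q. u = p @ v @ w @ y @ q \<and> v @ y \<noteq> [] \<and>
        (\<forall>i. p @ repeat i v @ w @ repeat i y @ q \<in> ?L)"
    by blast
  have "inj ?w" by (rule injI) (drule arg_cong[where f = length], simp)
  then have "infinite (range ?w)" by (simp add: finite_image_iff)
  with B(1) obtain n where n: "?w n \<notin> B" by (meson finite_subset image_subset_iff)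
  have "[] \<in> balanced a b" by (auto simp: balanced_def)
  moreover have "?w n \<in> descending c d e" unfolding descending_def by blast
  ultimately have "?w n \<in> ?L" unfolding separating_def by force
  from B(2)[OF this n] obtain p v x y q where
    w: "?w n = p @ v @ x @ y @ q" and vy: "v @ y \<noteq> []" and
    pump: "\<And>i. p @ repeat i v @ x @ repeat i y @ q \<in> ?L" by blast
  have "set (?w n) \<subseteq> {c, d, e}" by auto
  then have letters: "set p \<subseteq> {c, d, e}" "set v \<subseteq> {c, d, e}" "set x \<subseteq> {c, d, e}" "set y \<subseteq> {c, d, e}"
    "set q \<subseteq> {c, d, e}" unfolding w by auto
  have "p @ x @ q \<in> ?L" using pump[of 0] by simp
  from separating_cde[OF this _ dist] letters have w0: "p @ x @ q \<in> descending c d e" by simp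
  have "p @ (v @ v) @ x @ (y @ y) @ q \<in> ?L" using pump[of 2] by (simp add: numeral_2_eq_2)
  from separating_cde[OF this _ dist] letters have w2: "p @ (v @ v) @ x @ (y @ y) @ q \<in> descending c d e"
    by simp
  have cde: "distinct [c, d, e]" using dist by simp
  have sum: "count_list (p @ x @ q) z + count_list (v @ y) z = n" if "z \<in> {c, d, e}" for z
    using arg_cong[OF w, of "\<lambda>x. count_list x z"] that cde by (auto simp: count_list_append count_list_replicate)
  \<comment> \<open>Removing one copy of the pump from equal counts shows that it has at most as
    many \<open>c\<close> as \<open>d\<close> and at most as many \<open>d\<close> as
    \<open>e\<close>; adding one copy gives the reverse inequalities.\<close>
  have eq: "count_list (v @ y) c = count_list (v @ y) d" "count_list (v @ y) d = count_list (v @ y) e"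
    using descendingD(2,3)[OF w0 cde] descendingD(2,3)[OF w2 cde] sum[of c] sum[of d] sum[of e]
    by (simp_all add: count_list_append count_list_replicate)
  obtain z where "z \<in> set (v @ y)" using vy by (cases "v @ y") auto
  with letters have "z \<in> {c, d, e}" "count_list (v @ y) z \<noteq> 0" by (auto simp: count_list_0_iff)
  with eq have "count_list (v @ y) c \<noteq> 0" "count_list (v @ y) d \<noteq> 0" "count_list (v @ y) e \<noteq> 0" by auto
  then have mem: "c \<in> set v \<union> set y" "d \<in> set v \<union> set y" "e \<in> set v \<union> set y"
    by (auto simp: count_list_0_iff)
  let ?r = "\<lambda>z. if z = c then 0 else if z = d then 1 else 2 :: nat"
  have "sorted (map ?r (p @ (v @ v) @ (x @ (y @ y) @ q)))" using descendingD(1)[OF w2 cde] by simp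
  from sorted_square_constant[OF this] have v: "?r s = ?r t" if "s \<in> set v" "t \<in> set v" for s t
    using that by blast
  have "sorted (map ?r ((p @ v @ v @ x) @ (y @ y) @ q))" using descendingD(1)[OF w2 cde] by simp
  from sorted_square_constant[OF this] have y: "?r s = ?r t" if "s \<in> set y" "t \<in> set y" for s t
    using that by blast
  \<comment> \<open>By constant rank, \<open>v\<close> and \<open>y\<close> each contain at most one
    of the three letters, yet together they contain all three.\<close>
  show False
    using mem v[of c d] v[of d e] v[of c e] y[of c d] y[of d e] y[of c e] cde by auto
qed

theorem theorem3:
  assumes "infinite (UNIV :: 'a set)"
  shows "pn_cov_langs \<union> cf_langs \<subset> (rpn_cov_langs :: 'a list set set)"
proof -
  have "pn_cov_langs \<subseteq> (rpn_cov_langs :: 'a list set set)"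
  proof
    fix L :: "'a list set" assume "L \<in> pn_cov_langs"
    from concat_rpn_cov_langs[OF singleton_Nil_cf this] show "L \<in> rpn_cov_langs" by simp
  qed
  moreover have "cf_langs \<subseteq> (rpn_cov_langs :: 'a list set set)"
  proof
    fix L :: "'a list set" assume "L \<in> cf_langs"
    from concat_rpn_cov_langs[OF this singleton_Nil_pn] show "L \<in> rpn_cov_langs" by simp
  qed
  \<comment> \<open>The infinite letter type supplies five distinct letters.\<close>
  moreover obtain f :: "nat \<Rightarrow> 'a" where "inj f" using infinite_countable_subset[OF assms] by blast
  then have dist: "distinct [f 0, f 1, f 2, f 3, f 4]" by (simp add: inj_eq)
  have "separating (f 0) (f 1) (f 2) (f 3) (f 4) \<in> rpn_cov_langs"
    unfolding separating_def by (rule concat_rpn_cov_langs[OF balanced_cf descending_pn])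
  ultimately show ?thesis using separating_not_pn[OF dist] separating_not_cf[OF dist] by blast
qed

end
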